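(* For any $\mathscr{B}\subset\mathbb{N}$ and any $\nu\in\mathcal{P}(S,\widetilde{X}_\eta)$, there exists $\rho\in\mathcal{P}(S\times S,X_\eta\times\{0,1\}^{\mathbb{Z}})$ whose projection onto the first coordinate equals $\nu_\eta$ and such that $M_*(\rho)=\nu$, where $M\colon X_\eta\times\{0,1\}^{\mathbb{Z}}\to\widetilde{X}_\eta$ stands for the coordinatewise multiplication.
   Context: $\mathbb{N}=\{1,2,\dots\}$. For $\mathscr{B}\subset\mathbb{N}$ let $\mathcal{F}_{\mathscr{B}}:=\mathbb{Z}\setminus\bigcup_{b\in\mathscr{B}}b\mathbb{Z}$; $\eta\in\{0,1\}^{\mathbb{Z}}$ is the characteristic function of $\mathcal{F}_{\mathscr{B}}$. $S$ is the left shift on $\{0,1\}^{\mathbb{Z}}$ (product topology), and $X_\eta$ is the closure of $\{S^m\eta : m\in\mathbb{Z}\}$. A subshift $X\subset\{0,1\}^{\mathbb{Z}}$ (closed, $S$-invariant set) is hereditary if $x\in X$ and $y\le x$ coordinatewise imply $y\in X$; $\widetilde{X}_\eta$ is the smallest hereditary subshift containing $X_\eta$. $\mathcal{P}(T,X)$ denotes the set of $T$-invariant Borel probability measures on $X$. Mirsky measure: let $G$ be the closure of $\{(n \bmod b)_{b\in\mathscr{B}} : n\in\mathbb{Z}\}$ in the compact group $\prod_{b\in\mathscr{B}}\mathbb{Z}/b\mathbb{Z}$, let $\mathbb{P}$ be the normalized Haar measure of $G$, and define $\varphi\colon G\to\{0,1\}^{\mathbb{Z}}$ by $\varphi(g)(n)=1$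 iff $n\not\equiv -g_b \bmod b$ for all $b\in\mathscr{B}$ (and $0$ otherwise); then $\nu_\eta:=\varphi_*(\mathbb{P})$, an $S$-invariant measure with $\nu_\eta(X_\eta)=1$. *)

theory Defs
  imports "HOL-Probability.Probability" "HOL-Algebra.Product_Groups"
begin

(* The full shift on {0,1} is the type int => bool: True stands for 1 and False for 0. The library
   gives bool the discrete topology and the function type the product topology, "\<le>" on functions is
   the coordinatewise order, and the product in {0,1} is conjunction. *)

type_synonym bseq = "int \<Rightarrow> bool"

definition shift_by :: "int \<Rightarrow> bseq \<Rightarrow> bseq" where
  "shift_by m x = (\<lambda>n. x (n + m))"

definition left_shift :: "bseq \<Rightarrow> bseq" where
  "left_shift = shift_by 1"

definition free_ints :: "nat set \<Rightarrow> int set" where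
  "free_ints B = UNIV - (\<Union>b\<in>B. range (\<lambda>k. int b * k))"

definition eta :: "nat set \<Rightarrow> bseq" where
  "eta B = (\<lambda>n. n \<in> free_ints B)"

definition X_eta :: "nat set \<Rightarrow> bseq set" where
  "X_eta B = closure (range (\<lambda>m. shift_by m (eta B)))"

definition subshift :: "bseq set \<Rightarrow> bool" where
  "subshift X \<longleftrightarrow> closed X \<and> left_shift ` X = X"

definition hereditary :: "bseq set \<Rightarrow> bool" where
  "hereditary X \<longleftrightarrow> (\<forall>x\<in>X. \<forall>y. y \<le> x \<longrightarrow> y \<in> X)"

(* Hereditary subshifts are closed under intersection, so this is the smallest one over X_eta B. *)
definition hereditary_closure_X_eta :: "nat set \<Rightarrow> bseq set" where
  "hereditary_closure_X_eta B = \<Inter>{X. subshift X \<and> hereditary X \<and> X_eta B \<subseteq> X}"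

(* A Borel probability measure on a Borel set X is represented by its extension to the ambient
   space, that is, by a Borel probability measure of the ambient type giving full mass to X. *)
definition inv_prob :: "('a::topological_space \<Rightarrow> 'a) \<Rightarrow> 'a set \<Rightarrow> 'a measure set" where
  "inv_prob T X = {\<mu>. sets \<mu> = sets borel \<and> prob_space \<mu> \<and> X \<in> sets borel \<and> emeasure \<mu> X = 1
                     \<and> T \<in> borel_measurable borel \<and> distr \<mu> borel T = \<mu>}"

(* On a compact metrizable group every finite Borel measure is regular, so regularity is not part
   of the definition. *)
definition normalized_haar :: "('a, 'b) monoid_scheme \<Rightarrow> 'a topology \<Rightarrow> 'a measure \<Rightarrow> bool" where
  "normalized_haar H T \<mu> \<longleftrightarrow>
     sets \<mu> = sets (sigma (topspace T) {U. openin T U}) \<and> prob_space \<mu> \<and>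
     (\<forall>g\<in>carrier H. \<forall>A\<in>sets \<mu>. emeasure \<mu> (g <#\<^bsub>H\<^esub> A) = emeasure \<mu> A)"

(* Residues mod b are represented by {0..<b}, as in integer_mod_group; points of the product are
   extensional functions on B. *)
definition residue_top :: "nat set \<Rightarrow> (nat \<Rightarrow> int) topology" where
  "residue_top B = product_topology (\<lambda>b. discrete_topology (carrier (integer_mod_group b))) B"

definition G_set :: "nat set \<Rightarrow> (nat \<Rightarrow> int) set" where
  "G_set B = residue_top B closure_of range (\<lambda>n. \<lambda>b\<in>B. n mod int b)"

definition G_group :: "nat set \<Rightarrow> (nat \<Rightarrow> int) monoid" where
  "G_group B = (product_group B integer_mod_group)\<lparr>carrier := G_set B\<rparr>"

definition haar_G :: "nat set \<Rightarrow> (nat \<Rightarrow> int) measure" where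
  "haar_G B = (THE P. normalized_haar (G_group B) (subtopology (residue_top B) (G_set B)) P)"

definition phi :: "nat set \<Rightarrow> (nat \<Rightarrow> int) \<Rightarrow> bseq" where
  "phi B g = (\<lambda>n. \<forall>b\<in>B. n mod int b \<noteq> (- g b) mod int b)"

definition mirsky :: "nat set \<Rightarrow> bseq measure" where
  "mirsky B = distr (haar_G B) borel (phi B)"

definition coord_mult :: "bseq \<times> bseq \<Rightarrow> bseq" where
  "coord_mult = (\<lambda>(x, y). \<lambda>n. x n \<and> y n)"

end

theory Submission
  imports Defs
begin

text \<open>
  A pair \<open>(g, y)\<close> of a point of the group \<open>G\<close> and a \<open>0-1\<close> sequence with \<open>y \<le> \<phi>(g)\<close> satisfies
  \<open>\<phi>(g) \<cdot> y = y\<close>. So it suffices to find a probability measure \<open>\<mu>\<close> on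
  \<open>K = {(g, y). y \<le> \<phi>(g)}\<close> that is invariant under (rotation by \<open>(1, 1, ...)\<close>) \<open>\<times>\<close> (shift) and has
  second marginal \<open>\<nu>\<close>: the law \<open>\<rho>\<close> of \<open>(\<phi>(g), y)\<close> under \<open>\<mu>\<close> is then invariant and
  multiplies to \<open>\<nu>\<close>. Its first marginal is the Mirsky measure, because the first marginal of
  \<open>\<mu>\<close> is invariant under the rotation, and such a measure on \<open>G\<close> is unique and equal to the Haar
  measure: all residue classes modulo a finite part of \<open>B\<close> are permuted transitively by the rotation
  and so have the same mass (\<open>haar_G_eq\<close>). Two things remain.

  (1) Existence of \<open>\<mu>\<close> (\<open>lift_invariant_measure\<close>). For each \<open>k\<close> the sequences that lie below some
  translate of the periodic sequence \<open>\<eta>(B \<inter> {..k})\<close> form a hereditary subshift containing \<open>X_eta\<close>, so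
  every \<open>y\<close> in the hereditary closure has such a translate. Choosing it measurably gives, from \<open>\<nu>\<close>, a
  measure on pairs that satisfies the constraints of \<open>K\<close> coming from \<open>b \<le> k\<close>; averaging it along
  orbits and letting \<open>k\<close> grow gives \<open>\<mu>\<close>, since every single constraint
  "\<open>y n\<close> excludes \<open>g b = - n\<close> modulo \<open>b\<close>" is a clopen condition.

  (2) The Mirsky measure is carried by \<open>X_eta\<close> (\<open>mirsky_X_eta\<close>). This is a form of the
  Davenport-Erdos theorem on sets of multiples. Let \<open>\<mu>\<close> now be a limit, as \<open>s\<close> decreases to \<open>1\<close>, of the
  law of \<open>(n, S\<^sup>n \<eta>)\<close> with \<open>n \<ge> 1\<close> of weight proportional to \<open>n\<^sup>-\<^sup>s\<close>. It is invariant, the first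
  coordinate \<open>g\<close> is Haar distributed, and almost surely \<open>x \<in> X_eta\<close> and \<open>x \<le> \<phi>(g)\<close>. To see that
  \<open>x = \<phi>(g)\<close> almost surely it is enough, by invariance, that \<open>x 0\<close> is at least as likely as
  \<open>\<phi>(g) 0\<close>: the multiples of \<open>B\<close> must not have larger limiting weight than the supremum of the densities
  of the multiples of finite parts of \<open>B\<close>. The point is that the weight of a set closed
  under multiples can only grow as \<open>s\<close> decreases (\<open>zeta_pmf_multiples_antimono\<close>). For fixed \<open>s\<close> the multiples
  of a finite part of \<open>B\<close> thus weigh at most their density, and countable additivity at this fixed \<open>s\<close>
  carries the bound over to \<open>B\<close>, uniformly in \<open>s\<close>.

  Both limits are instances of one compactness statement, \<open>weighted_Krylov_Bogoliubov\<close>.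
\<close>

section \<open>Limits of measures on compact spaces with many clopen sets\<close>

definition clopens :: "'a topology \<Rightarrow> 'a set set" where
  "clopens X = {U. openin X U \<and> closedin X U}"

text \<open>On the zero-dimensional compact spaces below, this is the Borel sigma-algebra. Clopen sets are used as
  generators because convergence of measures can be tested on them by their plain values.\<close>
definition clopen_sigma :: "'a topology \<Rightarrow> 'a measure" where
  "clopen_sigma X = sigma (topspace X) (clopens X)"

lemma clopens_subset: "A \<in> clopens X \<Longrightarrow> A \<subseteq> topspace X"
  by (auto simp: clopens_def dest: openin_subset)

lemma clopens_topspace [simp]: "topspace X \<in> clopens X"
  by (auto simp: clopens_def)

lemma clopens_empty [simp]: "{} \<in> clopens X"
  by (auto simp: clopens_def)

lemma clopens_Int: "A \<in> clopens X \<Longrightarrow> C \<in> clopens X \<Longrightarrow> A \<inter> C \<in> clopens X"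
  by (auto simp: clopens_def)

lemma clopens_Un: "A \<in> clopens X \<Longrightarrow> C \<in> clopens X \<Longrightarrow> A \<union> C \<in> clopens X"
  by (auto simp: clopens_def)

lemma clopens_Diff: "A \<in> clopens X \<Longrightarrow> C \<in> clopens X \<Longrightarrow> A - C \<in> clopens X"
  by (auto simp: clopens_def)

lemma algebra_clopens: "algebra (topspace X) (clopens X)"
  by (rule algebra_iff_Un[THEN iffD2]) (auto simp: clopens_Un clopens_Diff dest: clopens_subset)

lemma clopens_vimage:
  assumes "continuous_map X Y f" "A \<in> clopens Y"
  shows "f -` A \<inter> topspace X \<in> clopens X"
proof -
  have "f -` A \<inter> topspace X = {x \<in> topspace X. f x \<in> A}" by auto
  then show ?thesis
    using assms by (auto simp: clopens_def openin_continuous_map_preimage closedin_continuous_map_preimage)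
qed

lemma clopens_Compl: "{x \<in> topspace X. P x} \<in> clopens X \<Longrightarrow> {x \<in> topspace X. \<not> P x} \<in> clopens X"
  using clopens_Diff[OF clopens_topspace[of X], of "{x \<in> topspace X. P x}"]
  by (simp add: set_diff_eq conj_commute cong: conj_cong)

lemma clopens_conj:
  "{x \<in> topspace X. P x} \<in> clopens X \<Longrightarrow> {x \<in> topspace X. Q x} \<in> clopens X \<Longrightarrow> {x \<in> topspace X. P x \<and> Q x} \<in> clopens X"
  using clopens_Int[of "{x \<in> topspace X. P x}" X "{x \<in> topspace X. Q x}"]
  by (simp add: Int_def conj_ac cong: conj_cong)

lemma clopens_ball:
  assumes "finite I" "\<And>i. i \<in> I \<Longrightarrow> {x \<in> topspace X. P i x} \<in> clopens X"
  shows "{x \<in> topspace X. \<forall>i\<in>I. P i x} \<in> clopens X"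
  using assms
proof (induction I rule: finite_induct)
  case (insert i I)
  then show ?case by (simp add: clopens_conj)
qed auto

lemma clopens_bex:
  assumes "finite I" "\<And>i. i \<in> I \<Longrightarrow> {x \<in> topspace X. P i x} \<in> clopens X"
  shows "{x \<in> topspace X. \<exists>i\<in>I. P i x} \<in> clopens X"
  using clopens_Compl[OF clopens_ball[of I X "\<lambda>i x. \<not> P i x"]] assms clopens_Compl[of X] by simp

lemma clopens_of_continuous:
  assumes "continuous_map X Y f" "{y \<in> topspace Y. P y} \<in> clopens Y"
  shows "{x \<in> topspace X. P (f x)} \<in> clopens X"
proof -
  have "f -` {y \<in> topspace Y. P y} \<inter> topspace X = {x \<in> topspace X. P (f x)}"
    using assms(1) by (auto simp: continuous_map_def)
  then show ?thesis using clopens_vimage[OF assms] by simp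
qed

lemma clopens_discrete: "U \<subseteq> S \<Longrightarrow> U \<in> clopens (discrete_topology S)"
  by (auto simp: clopens_def closedin_def)

lemma space_clopen_sigma [simp]: "space (clopen_sigma X) = topspace X"
  and sets_clopen_sigma: "sets (clopen_sigma X) = sigma_sets (topspace X) (clopens X)"
  unfolding clopen_sigma_def using clopens_subset[of _ X]
  by (auto intro!: space_measure_of sets_measure_of)

lemma clopens_in_sets: "A \<in> clopens X \<Longrightarrow> A \<in> sets (clopen_sigma X)"
  by (auto simp: sets_clopen_sigma)

lemma measurable_clopen_sigmaI:
  assumes "f \<in> space M \<rightarrow> topspace X" "\<And>A. A \<in> clopens X \<Longrightarrow> f -` A \<inter> space M \<in> sets M"
  shows "f \<in> measurable M (clopen_sigma X)"
  unfolding clopen_sigma_def using assms clopens_subset[of _ X]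
  by (intro measurable_measure_of) auto

lemma measurable_continuous_clopen_sigma:
  assumes "continuous_map X Y f"
  shows "f \<in> measurable (clopen_sigma X) (clopen_sigma Y)"
  using assms by (intro measurable_clopen_sigmaI)
    (auto simp: continuous_map_def Pi_iff intro!: clopens_in_sets clopens_vimage[OF assms])

lemma measure_eqI_clopens:
  assumes M: "prob_space M" "sets M = sets (clopen_sigma X)"
    and N: "prob_space N" "sets N = sets (clopen_sigma X)"
    and eq: "\<And>A. A \<in> clopens X \<Longrightarrow> measure M A = measure N A"
  shows "M = N"
proof (rule measure_eqI_generator_eq)
  interpret M: prob_space M by fact
  interpret N: prob_space N by fact
  show "Int_stable (clopens X)" by (auto simp: Int_stable_def clopens_Int)
  show "clopens X \<subseteq> Pow (topspace X)" by (auto dest: clopens_subset)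
  show "emeasure M A = emeasure N A" if "A \<in> clopens X" for A
    using eq[OF that] by (simp add: M.emeasure_eq_measure N.emeasure_eq_measure)
  show "sets M = sigma_sets (topspace X) (clopens X)" "sets N = sigma_sets (topspace X) (clopens X)"
    using M N by (simp_all add: sets_clopen_sigma)
  show "range (\<lambda>_::nat. topspace X) \<subseteq> clopens X" by auto
  show "(\<Union>i::nat. topspace X) = topspace X" by auto
  show "emeasure M (topspace X) \<noteq> \<infinity>" by simp
qed

text \<open>The values of a sequence of finitely additive probabilities on clopen sets form a sequence in a
  cube \<open>[0,1]\<^sup>I\<close>, so they have a cluster point by Tychonoff. The cluster point is again finitely additive, and
  it is automatically countably additive: a decreasing sequence of clopen sets with empty
  intersection in a compact space is eventually empty, which is all that Caratheodory's extension asks for.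
  A filter below \<open>sequentially\<close> takes the place of a subsequence, which a cluster point in a
  non-metrizable cube does not provide.\<close>
lemma compact_clopen_cluster_measure:
  fixes m :: "nat \<Rightarrow> 'a set \<Rightarrow> real"
  assumes cpt: "compact_space X"
    and nn: "\<And>k A. A \<in> clopens X \<Longrightarrow> 0 \<le> m k A"
    and add: "\<And>k A C. A \<in> clopens X \<Longrightarrow> C \<in> clopens X \<Longrightarrow> A \<inter> C = {} \<Longrightarrow> m k (A \<union> C) = m k A + m k C"
    and tot: "\<And>k. m k (topspace X) = 1"
  obtains F \<mu> where "F \<noteq> bot" "F \<le> sequentially" "prob_space \<mu>" "sets \<mu> = sets (clopen_sigma X)"
    "\<And>A. A \<in> clopens X \<Longrightarrow> ((\<lambda>k. m k A) \<longlongrightarrow> measure \<mu> A) F"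
proof -
  have le1: "m k A \<le> 1" if "A \<in> clopens X" for k A
  proof -
    have "m k (A \<union> (topspace X - A)) = m k A + m k (topspace X - A)"
      using that by (intro add clopens_Diff) auto
    moreover have "A \<union> (topspace X - A) = topspace X" using clopens_subset[OF that] by auto
    moreover have "m k (topspace X - A) \<ge> 0" using that by (intro nn clopens_Diff) auto
    ultimately show ?thesis using tot[of k] by simp
  qed
  define q where "q k A = (if A \<in> clopens X then m k A else 0)" for k A
  define S where "S = (PiE UNIV (\<lambda>_::'a set. {0..1::real}))"
  have "compact S"
  proof -
    have "compactin (product_topology (\<lambda>_::'a set. euclidean :: real topology) UNIV) S"
      unfolding S_def by (subst compactin_PiE) auto
    then show ?thesis by (simp add: euclidean_product_topology)
  qed
  moreover have "q k \<in> S" for k using nn le1 by (auto simp: S_def q_def)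
  ultimately obtain x where x: "inf (nhds x) (filtermap q sequentially) \<noteq> bot"
    unfolding compact_filter by (metis (no_types, lifting) always_eventually eventually_filtermap
        filtermap_bot_iff sequentially_bot)
  \<comment> \<open>the part of \<open>sequentially\<close> along which \<open>q\<close> approaches its cluster point \<open>x\<close>\<close>
  define F where "F = inf (filtercomap q (nhds x)) sequentially"
  have Fbot: "F \<noteq> bot"
  proof
    assume "F = bot"
    then have "eventually (\<lambda>_. False) F" by simp
    then obtain P Q where "eventually P (filtercomap q (nhds x))" "eventually Q sequentially"
      and PQ: "\<And>k. P k \<Longrightarrow> Q k \<Longrightarrow> False"
      unfolding F_def eventually_inf by auto
    moreover then obtain P' where "eventually P' (nhds x)" "\<And>k. P' (q k) \<Longrightarrow> P k"
      unfolding eventually_filtercomap by auto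
    moreover from calculation have "eventually (\<lambda>z. \<not> P' z) (filtermap q sequentially)"
      unfolding eventually_filtermap by (auto elim!: eventually_mono)
    ultimately have "eventually (\<lambda>_. False) (inf (nhds x) (filtermap q sequentially))"
      unfolding eventually_inf by blast
    then show False using x by (simp add: eventually_False)
  qed
  have Fseq: "F \<le> sequentially" by (simp add: F_def)
  have "filterlim q (nhds x) F"
    unfolding F_def by (rule filterlim_mono[OF filterlim_filtercomap]) auto
  then have qlim: "((\<lambda>k. q k A) \<longlongrightarrow> x A) F" for A
    by (rule continuous_on_tendsto_compose[OF continuous_on_product_coordinates]) auto
  then have lim: "((\<lambda>k. m k A) \<longlongrightarrow> x A) F" if "A \<in> clopens X" for A
    using that qlim[of A] by (simp add: q_def)
  have x_nn: "x A \<ge> 0" if "A \<in> clopens X" for A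
    using tendsto_lowerbound[OF lim[OF that] _ Fbot] nn[OF that] by auto
  have x_add: "x (A \<union> C) = x A + x C" if "A \<in> clopens X" "C \<in> clopens X" "A \<inter> C = {}" for A C
  proof (rule tendsto_unique[OF Fbot])
    show "((\<lambda>k. m k (A \<union> C)) \<longlongrightarrow> x (A \<union> C)) F" using that by (intro lim clopens_Un)
    show "((\<lambda>k. m k (A \<union> C)) \<longlongrightarrow> x A + x C) F"
      using tendsto_add[OF lim[OF that(1)] lim[OF that(2)]] that by (simp add: add)
  qed
  have x_empty: "x {} = 0" using x_add[of "{}" "{}"] by simp
  have x_tot: "x (topspace X) = 1"
    using tendsto_unique[OF Fbot lim[of "topspace X"]] tot by simp
  interpret algebra "topspace X" "clopens X" by (rule algebra_clopens)
  have "\<exists>\<mu> :: 'a set \<Rightarrow> ennreal. (\<forall>s \<in> clopens X. \<mu> s = ennreal (x s)) \<and>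
      measure_space (topspace X) (sigma_sets (topspace X) (clopens X)) \<mu>"
  proof (rule caratheodory_empty_continuous)
    show "positive (clopens X) (\<lambda>s. ennreal (x s))" by (simp add: positive_def x_empty)
    show "additive (clopens X) (\<lambda>s. ennreal (x s))"
      by (auto simp: additive_def x_add x_nn ennreal_plus)
    fix A :: "nat \<Rightarrow> 'a set" assume A: "range A \<subseteq> clopens X" "decseq A" "(\<Inter>i. A i) = {}"
    have "\<exists>n. A n = {}"
    proof (rule ccontr)
      assume *: "\<not> ?thesis"
      have "(\<Inter>n. A n) \<noteq> {}"
        by (rule compact_space_imp_nest[OF cpt]) (use A * in \<open>auto simp: clopens_def\<close>)
      with A show False by simp
    qed
    then obtain n where "A n = {}" by auto
    then have "A i = {}" if "i \<ge> n" for i using A(2) that by (auto simp: decseq_def)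
    then have "eventually (\<lambda>i. ennreal (x (A i)) = 0) sequentially"
      unfolding eventually_sequentially by (intro exI[of _ n]) (simp add: x_empty)
    then show "(\<lambda>i. ennreal (x (A i))) \<longlonglongrightarrow> 0" by (rule tendsto_eventually)
  qed auto
  then obtain f where f: "\<And>s. s \<in> clopens X \<Longrightarrow> f s = ennreal (x s)"
    and ms: "measure_space (topspace X) (sigma_sets (topspace X) (clopens X)) f" by auto
  define \<mu> where "\<mu> = measure_of (topspace X) (clopens X) f"
  have sets: "sets \<mu> = sets (clopen_sigma X)"
    using space_closed unfolding \<mu>_def sets_clopen_sigma by (rule sets_measure_of)
  have em: "emeasure \<mu> A = ennreal (x A)" if "A \<in> clopens X" for A
  proof -
    have "emeasure \<mu> A = f A"
      using ms space_closed that unfolding measure_space_def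
      by (intro emeasure_measure_of[OF \<mu>_def]) (auto simp: sets sets_clopen_sigma)
    then show ?thesis using f[OF that] by simp
  qed
  have sp: "space \<mu> = topspace X" using sets_eq_imp_space_eq[OF sets] by simp
  show ?thesis
  proof (rule that[OF Fbot Fseq _ sets])
    show "prob_space \<mu>" by (rule prob_spaceI) (simp add: sp em x_tot)
    show "((\<lambda>k. m k A) \<longlongrightarrow> measure \<mu> A) F" if "A \<in> clopens X" for A
      using lim[OF that] em[OF that] x_nn[OF that] by (simp add: measure_def)
  qed
qed

section \<open>Invariant limits of weighted orbit averages\<close>

lemma pmf_expectation_sums:
  fixes p :: "nat pmf" and a :: "nat \<Rightarrow> real"
  assumes "\<And>j. \<bar>a j\<bar> \<le> 1"
  shows "(\<lambda>j. pmf p j * a j) sums measure_pmf.expectation p a"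
proof -
  have int: "integrable (measure_pmf p) a"
    by (rule measure_pmf.integrable_const_bound[where B = 1]) (use assms in auto)
  have "integrable (count_space UNIV) (\<lambda>j. pmf p j * a j)"
    using int by (subst (asm) measure_pmf_eq_density, subst (asm) integrable_density) auto
  then have "(\<lambda>j. pmf p j * a j) sums (LINT j|count_space UNIV. pmf p j * a j)"
    by (rule sums_integral_count_space_nat)
  also have "(LINT j|count_space UNIV. pmf p j * a j) = measure_pmf.expectation p a"
    by (subst measure_pmf_eq_density, subst integral_density) auto
  finally show ?thesis .
qed

text \<open>Summation by parts: the difference equals \<open>\<Sum>j. (p j - p (Suc j)) * a (Suc j) - p 0 * a 0\<close>, where the
  coefficients \<open>p j - p (Suc j)\<close> are nonnegative and telescope to \<open>p 0\<close>. This is what makes averages with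
  flat decreasing weights asymptotically invariant.\<close>
lemma antimono_pmf_expectation_shift:
  fixes p :: "nat pmf" and a :: "nat \<Rightarrow> real"
  assumes anti: "antimono (pmf p)" and a: "\<And>j. 0 \<le> a j" "\<And>j. a j \<le> 1"
  shows "\<bar>measure_pmf.expectation p (\<lambda>j. a (Suc j)) - measure_pmf.expectation p a\<bar> \<le> pmf p 0"
proof -
  let ?E0 = "measure_pmf.expectation p a" and ?E1 = "measure_pmf.expectation p (\<lambda>j. a (Suc j))"
  have E1: "(\<lambda>j. pmf p j * a (Suc j)) sums ?E1"
    by (rule pmf_expectation_sums) (use a in auto)
  have "(\<lambda>j. pmf p j * a j) sums ?E0"
    by (rule pmf_expectation_sums) (use a in auto)
  then have E0: "(\<lambda>j. pmf p (Suc j) * a (Suc j)) sums (?E0 - pmf p 0 * a 0)"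
    by (subst sums_Suc_iff) simp
  have D: "(\<lambda>j. (pmf p j - pmf p (Suc j)) * a (Suc j)) sums (?E1 - (?E0 - pmf p 0 * a 0))"
    using sums_diff[OF E1 E0] by (simp add: algebra_simps)
  have "(\<lambda>j. pmf p j * 1) sums measure_pmf.expectation p (\<lambda>_. 1)"
    by (rule pmf_expectation_sums) auto
  then have "pmf p \<longlonglongrightarrow> 0" by (auto simp: sums_iff intro: summable_LIMSEQ_zero)
  then have T: "(\<lambda>j. pmf p j - pmf p (Suc j)) sums (pmf p 0 - 0)"
    by (rule telescope_sums')
  have dec: "pmf p (Suc j) \<le> pmf p j" for j using anti by (simp add: antimono_def)
  have "0 \<le> ?E1 - (?E0 - pmf p 0 * a 0)"
    by (rule sums_le[OF _ sums_zero D]) (use dec a in auto)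
  moreover have "?E1 - (?E0 - pmf p 0 * a 0) \<le> pmf p 0 - 0"
    by (rule sums_le[OF _ D T]) (use dec a in \<open>auto intro!: mult_left_le\<close>)
  moreover have "0 \<le> pmf p 0 * a 0" "pmf p 0 * a 0 \<le> pmf p 0"
    using a by (auto intro!: mult_left_le)
  ultimately show ?thesis by linarith
qed

lemma measurable_iterate:
  assumes "continuous_map X X T" "f \<in> measurable M (clopen_sigma X)"
  shows "(\<lambda>y. (T ^^ j) (f y)) \<in> measurable M (clopen_sigma X)"
proof (induction j)
  case (Suc j)
  show ?case
    using measurable_compose[OF Suc measurable_continuous_clopen_sigma[OF assms(1)]] by simp
qed (use assms(2) in simp)

text \<open>The classical construction averages uniformly over \<open>{..<k}\<close>. Any decreasing weights whose largest
  value tends to \<open>0\<close> serve as well, and zeta weights allow the use of multiplicative number theory. The starting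
  points \<open>f k\<close> are random and vary with \<open>k\<close>, so that the starting distributions can satisfy more and more
  constraints.\<close>
lemma weighted_Krylov_Bogoliubov:
  fixes p :: "nat \<Rightarrow> nat pmf" and N :: "nat \<Rightarrow> 'b measure" and f :: "nat \<Rightarrow> 'b \<Rightarrow> 'a"
  assumes cpt: "compact_space X" and cont: "continuous_map X X T"
    and N: "\<And>k. prob_space (N k)" and f: "\<And>k. f k \<in> measurable (N k) (clopen_sigma X)"
    and anti: "\<And>k. antimono (pmf (p k))" and p0: "(\<lambda>k. pmf (p k) 0) \<longlonglongrightarrow> 0"
  obtains F \<mu> where "F \<noteq> bot" "F \<le> sequentially" "prob_space \<mu>" "sets \<mu> = sets (clopen_sigma X)"
    "distr \<mu> (clopen_sigma X) T = \<mu>"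
    "\<And>A. A \<in> clopens X \<Longrightarrow> ((\<lambda>k. measure_pmf.expectation (p k)
       (\<lambda>j. measure (N k) {y \<in> space (N k). (T ^^ j) (f k y) \<in> A})) \<longlongrightarrow> measure \<mu> A) F"
proof -
  define a where "a k A j = measure (N k) {y \<in> space (N k). (T ^^ j) (f k y) \<in> A}" for k A j
  define m where "m k A = measure_pmf.expectation (p k) (a k A)" for k A
  have fm: "(\<lambda>y. (T ^^ j) (f k y)) \<in> measurable (N k) (clopen_sigma X)" for k j
    by (rule measurable_iterate[OF cont f])
  have ev: "{y \<in> space (N k). (T ^^ j) (f k y) \<in> A} \<in> sets (N k)" if "A \<in> clopens X" for k j A
    using measurable_sets[OF fm clopens_in_sets[OF that]] by (simp add: vimage_def Int_def conj_commute)
  have a01: "0 \<le> a k A j" "a k A j \<le> 1" for k A j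
    using prob_space.prob_le_1[OF N] by (auto simp: a_def)
  have a_int: "integrable (measure_pmf (p k)) (a k A)" for k A
    by (rule measure_pmf.integrable_const_bound[where B = 1]) (use a01 in auto)
  have fX: "(T ^^ j) (f k y) \<in> topspace X" if "y \<in> space (N k)" for j k y
    using measurable_space[OF fm that] by simp
  have m_add: "m k (A \<union> C) = m k A + m k C" if "A \<in> clopens X" "C \<in> clopens X" "A \<inter> C = {}" for k A C
  proof -
    interpret N: prob_space "N k" by (rule N)
    have "a k (A \<union> C) j = a k A j + a k C j" for j
    proof -
      have "{y \<in> space (N k). (T ^^ j) (f k y) \<in> A \<union> C} =
          {y \<in> space (N k). (T ^^ j) (f k y) \<in> A} \<union> {y \<in> space (N k). (T ^^ j) (f k y) \<in> C}"
        by auto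
      then show ?thesis unfolding a_def
        using that by (auto intro!: N.finite_measure_Union ev)
    qed
    then have "a k (A \<union> C) = (\<lambda>j. a k A j + a k C j)" by auto
    then show ?thesis by (simp add: m_def a_int)
  qed
  have m_tot: "m k (topspace X) = 1" for k
  proof -
    have "{y \<in> space (N k). (T ^^ j) (f k y) \<in> topspace X} = space (N k)" for j
      using fX by auto
    then have "a k (topspace X) = (\<lambda>_. 1)"
      by (intro ext) (simp add: a_def prob_space.prob_space[OF N])
    then show ?thesis by (simp add: m_def)
  qed
  obtain F \<mu> where F: "F \<noteq> bot" "F \<le> sequentially" and \<mu>: "prob_space \<mu>" "sets \<mu> = sets (clopen_sigma X)"
    and lim: "\<And>A. A \<in> clopens X \<Longrightarrow> ((\<lambda>k. m k A) \<longlongrightarrow> measure \<mu> A) F"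
    by (rule compact_clopen_cluster_measure[of X m, OF cpt _ m_add m_tot])
       (auto simp: m_def a01)
  have T: "T \<in> measurable \<mu> (clopen_sigma X)"
    using measurable_continuous_clopen_sigma[OF cont] measurable_cong_sets[OF \<mu>(2) refl] by blast
  interpret \<mu>: prob_space \<mu> by fact
  have sp: "space \<mu> = topspace X" using sets_eq_imp_space_eq[OF \<mu>(2)] by simp
  have "distr \<mu> (clopen_sigma X) T = \<mu>"
  proof (rule measure_eqI_clopens[where X = X])
    show "prob_space (distr \<mu> (clopen_sigma X) T)" by (rule \<mu>.prob_space_distr[OF T])
    fix A assume A: "A \<in> clopens X"
    let ?TA = "T -` A \<inter> topspace X"
    have TA: "?TA \<in> clopens X" by (rule clopens_vimage[OF cont A])
    have shift: "a k ?TA j = a k A (Suc j)" for k j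
      using fX by (auto simp: a_def intro!: arg_cong[where f = "measure (N k)"])
    have "\<bar>m k ?TA - m k A\<bar> \<le> pmf (p k) 0" for k
      using antimono_pmf_expectation_shift[where p = "p k" and a = "a k A", OF anti a01]
      by (simp add: m_def shift[abs_def])
    then have "(\<lambda>k. m k ?TA - m k A) \<longlonglongrightarrow> 0"
      by (intro Lim_null_comparison[OF _ p0]) auto
    then have "((\<lambda>k. m k ?TA - m k A) \<longlongrightarrow> 0) F" by (rule tendsto_mono[OF F(2)])
    moreover have "((\<lambda>k. m k ?TA - m k A) \<longlongrightarrow> measure \<mu> ?TA - measure \<mu> A) F"
      by (intro tendsto_diff lim TA A)
    ultimately have "measure \<mu> ?TA - measure \<mu> A = 0"
      using tendsto_unique[OF F(1)] by blast
    then show "measure (distr \<mu> (clopen_sigma X) T) A = measure \<mu> A"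
      by (simp add: measure_distr[OF T clopens_in_sets[OF A]] sp)
  qed (use \<mu> in auto)
  then show ?thesis
    using that[OF F \<mu>] lim unfolding m_def a_def by blast
qed

section \<open>Zeta weights and sets of multiples\<close>

text \<open>Jordan's totient function with a real exponent. It is the Moebius inverse of \<open>n powr \<alpha>\<close>, see
  \<open>sum_divisors_jordan_totient\<close>; the product formula makes its sign visible.\<close>
definition jordan_totient :: "real \<Rightarrow> nat \<Rightarrow> real" where
  "jordan_totient \<alpha> n = (\<Prod>p\<in>prime_factors n.
     (real p powr \<alpha>) ^ multiplicity p n - (real p powr \<alpha>) ^ (multiplicity p n - 1))"

lemma jordan_totient_nonneg:
  assumes "\<alpha> \<ge> 0"
  shows "jordan_totient \<alpha> n \<ge> 0"
  unfolding jordan_totient_def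
proof (intro prod_nonneg)
  fix p assume "p \<in> prime_factors n"
  then have "p \<ge> 1" using prime_ge_1_nat by auto
  then have "real p powr \<alpha> \<ge> 1" using assms by (intro ge_one_powr_ge_zero) auto
  then show "(real p powr \<alpha>) ^ multiplicity p n - (real p powr \<alpha>) ^ (multiplicity p n - 1) \<ge> 0"
    by (simp add: power_increasing)
qed

lemma jordan_totient_mult_coprime:
  assumes "coprime a b" "a > 0" "b > 0"
  shows "jordan_totient \<alpha> (a * b) = jordan_totient \<alpha> a * jordan_totient \<alpha> b"
proof -
  define f where "f n p = (real p powr \<alpha>) ^ multiplicity p n - (real p powr \<alpha>) ^ (multiplicity p n - 1)" for n p :: nat
  have pf: "prime_factors (a * b) = prime_factors a \<union> prime_factors b"
    using assms by (intro prime_factors_product) auto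
  have disj: "prime_factors a \<inter> prime_factors b = {}"
  proof (rule ccontr)
    assume "\<not> ?thesis"
    then obtain p where "p \<in> prime_factors a" "p \<in> prime_factors b" by auto
    then have "prime p" "p dvd a" "p dvd b" by (auto dest: in_prime_factors_imp_prime in_prime_factors_imp_dvd)
    then show False using assms(1) by (metis coprime_common_divisor not_prime_unit)
  qed
  have "f (a * b) p = f a p" if "p \<in> prime_factors a" for p
  proof -
    have "prime p" "\<not> p dvd b" using that disj assms by (auto simp: prime_factors_dvd)
    then show ?thesis using assms
      by (simp add: f_def prime_elem_multiplicity_mult_distrib not_dvd_imp_multiplicity_0)
  qed
  moreover have "f (a * b) p = f b p" if "p \<in> prime_factors b" for p
  proof -
    have "prime p" "\<not> p dvd a" using that disj assms by (auto simp: prime_factors_dvd)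
    then show ?thesis using assms
      by (simp add: f_def prime_elem_multiplicity_mult_distrib not_dvd_imp_multiplicity_0)
  qed
  ultimately have "prod (f (a * b)) (prime_factors (a * b)) = prod (f a) (prime_factors a) * prod (f b) (prime_factors b)"
    unfolding pf using disj by (simp add: prod.union_disjoint)
  then show ?thesis by (simp add: jordan_totient_def f_def)
qed

lemma jordan_totient_1 [simp]: "jordan_totient \<alpha> 1 = 1" "jordan_totient \<alpha> (Suc 0) = 1"
  by (simp_all add: jordan_totient_def)

lemma jordan_totient_prime_power:
  assumes "prime p"
  shows "jordan_totient \<alpha> (p ^ Suc i) = (real p powr \<alpha>) ^ Suc i - (real p powr \<alpha>) ^ i"
proof -
  have "prime_factors (p ^ Suc i) = {p}"
    by (subst prime_factorization_prime_power[OF assms]) simp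
  then show ?thesis using assms by (simp add: jordan_totient_def multiplicity_prime_power del: power_Suc)
qed

lemma sum_divisors_jordan_totient_prime_power:
  assumes "prime p"
  shows "(\<Sum>d | d dvd p ^ k. jordan_totient \<alpha> d) = (real p powr \<alpha>) ^ k"
proof -
  have eq: "{d. d dvd p ^ k} = (\<lambda>i. p ^ i) ` {..k}"
    using divides_primepow_nat[OF assms] by auto
  have "inj_on (\<lambda>i. p ^ i) {..k}"
    using prime_gt_1_nat[OF assms] by (auto simp: inj_on_def)
  then have "(\<Sum>d | d dvd p ^ k. jordan_totient \<alpha> d) = (\<Sum>i\<le>k. jordan_totient \<alpha> (p ^ i))"
    unfolding eq by (simp add: sum.reindex)
  also have "\<dots> = (real p powr \<alpha>) ^ k"
    by (induction k) (simp_all add: jordan_totient_prime_power[OF assms] del: power_Suc)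
  finally show ?thesis .
qed

lemma sum_divisors_mult_coprime:
  fixes g :: "nat \<Rightarrow> 'a :: comm_semiring_0"
  assumes ab: "coprime a b" "a > 0" "b > 0"
    and g: "\<And>x y. x dvd a \<Longrightarrow> y dvd b \<Longrightarrow> g (x * y) = g x * g y"
  shows "(\<Sum>d | d dvd a * b. g d) = (\<Sum>d | d dvd a. g d) * (\<Sum>d | d dvd b. g d)"
proof -
  have cop: "coprime x y" if "x dvd a" "y dvd b" for x y
    using ab that by (meson coprime_divisors)
  have "inj_on (\<lambda>(x, y). x * y) ({d. d dvd a} \<times> {d. d dvd b})"
  proof (intro inj_onI, clarsimp)
    fix x y x' y' assume *: "x dvd a" "y dvd b" "x' dvd a" "y' dvd b" "x * y = x' * y'"
    have "x dvd x'" using *(5) cop[of x y'] * by (metis coprime_dvd_mult_left_iff dvd_triv_left)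
    moreover have "x' dvd x" using *(5) cop[of x' y] * by (metis coprime_dvd_mult_left_iff dvd_triv_left)
    ultimately have "x = x'" by (rule dvd_antisym)
    moreover have "x > 0" using * ab by (auto intro!: Nat.gr0I)
    ultimately show "x = x' \<and> y = y'" using * by auto
  qed
  moreover have "{d. d dvd a * b} = (\<lambda>(x, y). x * y) ` ({d. d dvd a} \<times> {d. d dvd b})"
    using division_decomp[of _ a b] by (fastforce intro: mult_dvd_mono)
  ultimately have "(\<Sum>d | d dvd a * b. g d) = (\<Sum>(x, y)\<in>{d. d dvd a} \<times> {d. d dvd b}. g (x * y))"
    by (simp add: sum.reindex case_prod_unfold)
  also have "\<dots> = (\<Sum>(x, y)\<in>{d. d dvd a} \<times> {d. d dvd b}. g x * g y)"
    by (intro sum.cong) (auto simp: g)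
  finally show ?thesis by (simp add: sum.cartesian_product sum_product)
qed

text \<open>Both sides are multiplicative in \<open>n\<close>, and for a prime power the sum telescopes.\<close>
lemma sum_divisors_jordan_totient:
  assumes "n > 0"
  shows "(\<Sum>d | d dvd n. jordan_totient \<alpha> d) = real n powr \<alpha>"
  using assms
proof (induction n rule: less_induct)
  case (less n)
  show ?case
  proof (cases "n = 1")
    case False
    then obtain p where p: "prime p" "p dvd n" using prime_factor_nat by blast
    define k where "k = multiplicity p n"
    obtain m where m: "n = p ^ k * m" "\<not> p dvd m"
      by (rule multiplicity_decompose'[of n p]) (use less.prems p in \<open>auto simp: k_def dest: not_prime_unit\<close>)
    have "m > 0" using m less.prems by (cases "m = 0") auto
    have "k > 0"
    proof (rule Nat.gr0I)
      assume "k = 0"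
      with m p show False by simp
    qed
    then have "p ^ k > 1" using prime_gt_1_nat[OF p(1)] by (intro one_less_power)
    then have "m < n" using \<open>m > 0\<close> m by simp
    have cop: "coprime (p ^ k) m" using p m by (simp add: prime_imp_coprime coprime_power_left_iff)
    have "(\<Sum>d | d dvd n. jordan_totient \<alpha> d) =
        (\<Sum>d | d dvd p ^ k. jordan_totient \<alpha> d) * (\<Sum>d | d dvd m. jordan_totient \<alpha> d)"
      unfolding m(1)
    proof (rule sum_divisors_mult_coprime[OF cop _ \<open>m > 0\<close>])
      fix x y assume "x dvd p ^ k" "y dvd m"
      then show "jordan_totient \<alpha> (x * y) = jordan_totient \<alpha> x * jordan_totient \<alpha> y"
        using coprime_divisors[OF _ _ cop] dvd_pos_nat[of m y] dvd_pos_nat[of "p ^ k" x] \<open>m > 0\<close> prime_gt_0_nat[OF p(1)]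
        by (intro jordan_totient_mult_coprime) simp_all
    qed (use prime_gt_0_nat[OF p(1)] in simp)
    also have "\<dots> = (real p powr \<alpha>) ^ k * real m powr \<alpha>"
      using less.IH[OF \<open>m < n\<close> \<open>m > 0\<close>] sum_divisors_jordan_totient_prime_power[OF p(1)] by simp
    also have "\<dots> = real n powr \<alpha>"
      using prime_gt_0_nat[OF p(1)] unfolding m(1)
      by (simp add: powr_mult powr_realpow[symmetric] powr_powr mult.commute)
    finally show ?thesis .
  qed auto
qed

text \<open>The index \<open>k\<close> stands for the positive integer \<open>Suc k\<close>.\<close>
definition zeta_weight :: "real \<Rightarrow> nat \<Rightarrow> real" where
  "zeta_weight s k = real (Suc k) powr - s"

definition zeta_pmf :: "real \<Rightarrow> nat pmf" where
  "zeta_pmf s = embed_pmf (\<lambda>k. zeta_weight s k / (\<Sum>k. zeta_weight s k))"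

lemma zeta_weight_pos: "zeta_weight s k > 0"
  by (simp add: zeta_weight_def)

lemma summable_zeta_weight: "s > 1 \<Longrightarrow> summable (zeta_weight s)"
  using summable_real_powr_iff[of "-s"] unfolding zeta_weight_def
  by (subst summable_Suc_iff) simp

lemma suminf_zeta_weight_pos: "s > 1 \<Longrightarrow> (\<Sum>k. zeta_weight s k) > 0"
  by (intro suminf_pos summable_zeta_weight zeta_weight_pos)

lemma pmf_zeta:
  assumes "s > 1"
  shows "pmf (zeta_pmf s) k = zeta_weight s k / (\<Sum>k. zeta_weight s k)"
  unfolding zeta_pmf_def
proof (rule pmf_embed_pmf)
  have "(\<lambda>k. zeta_weight s k / (\<Sum>k. zeta_weight s k)) sums 1"
    using sums_divide[OF summable_sums[OF summable_zeta_weight[OF assms]], of "\<Sum>k. zeta_weight s k"]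
      suminf_zeta_weight_pos[OF assms] by simp
  then have "(\<Sum>k. ennreal (zeta_weight s k / (\<Sum>k. zeta_weight s k))) = ennreal 1"
    by (intro suminf_ennreal_eq)
      (use zeta_weight_pos suminf_zeta_weight_pos[OF assms] in \<open>auto simp: less_imp_le\<close>)
  then show "(\<integral>\<^sup>+k. ennreal (zeta_weight s k / (\<Sum>k. zeta_weight s k)) \<partial>count_space UNIV) = 1"
    by (simp add: nn_integral_count_space_nat)
qed (use zeta_weight_pos suminf_zeta_weight_pos[OF assms] in \<open>auto simp: less_imp_le\<close>)

lemma antimono_pmf_zeta:
  assumes "s > 1"
  shows "antimono (pmf (zeta_pmf s))"
  using assms suminf_zeta_weight_pos[OF assms]
  by (intro antimonoI) (auto simp: pmf_zeta zeta_weight_def intro!: divide_right_mono powr_mono2')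

text \<open>The mass at the first point is \<open>1 / \<zeta>(s)\<close>. With \<open>s = 1 + 1/n\<close> the first \<open>n\<close> terms of the series are
  \<open>i powr - s = (1/i) * i powr (- 1/n)\<close>, and \<open>i powr (1/n) \<le> n powr (1/n) \<le> 2\<close>; hence
  \<open>\<zeta>(s) \<ge> harm n / 2\<close>, which diverges.\<close>
lemma pmf_zeta_0_tendsto: "(\<lambda>k. pmf (zeta_pmf (1 + 1 / real (Suc k))) 0) \<longlonglongrightarrow> 0"
proof (rule Lim_null_comparison)
  show "(\<lambda>k. 2 / (harm (Suc k) :: real)) \<longlonglongrightarrow> 0"
    by (intro tendsto_divide_0[OF tendsto_const] filterlim_at_top_imp_at_infinity
        filterlim_compose[OF harm_at_top filterlim_Suc])
  have "norm (pmf (zeta_pmf (1 + 1 / real (Suc k))) 0) \<le> 2 / harm (Suc k)" for k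
  proof -
    define n where "n = Suc k"
    define s where "s = 1 + 1 / real n"
    have "n > 0" "s > 1" by (simp_all add: n_def s_def)
    have "real n powr (1 / real n) \<le> 2"
    proof -
      have "real n \<le> 2 powr real n"
        using of_nat_less_two_power[of n, where 'a = real] by (simp add: powr_realpow)
      then have "real n powr (1 / real n) \<le> (2 powr real n) powr (1 / real n)"
        by (intro powr_mono2) auto
      then show ?thesis using \<open>n > 0\<close> by (simp add: powr_powr)
    qed
    have *: "inverse (real i) / 2 \<le> zeta_weight s (i - 1)" if "i \<in> {1..n}" for i
    proof -
      have "real i powr (1 / real n) \<le> real n powr (1 / real n)"
        using that by (intro powr_mono2) auto
      then have i2: "real i powr (1 / real n) \<le> 2" using \<open>real n powr (1 / real n) \<le> 2\<close> by simp
      have "zeta_weight s (i - 1) = real i powr (- 1 - 1 / real n)"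
        using that by (simp add: zeta_weight_def s_def)
      also have "\<dots> = inverse (real i) / real i powr (1 / real n)"
        using that by (simp add: powr_diff powr_minus)
      also have "\<dots> \<ge> inverse (real i) / 2"
        using that i2 by (intro divide_left_mono) auto
      finally show ?thesis .
    qed
    have "harm n / 2 = (\<Sum>i\<in>{1..n}. inverse (real i) / 2)"
      by (simp add: harm_def sum_divide_distrib)
    also have "\<dots> \<le> (\<Sum>i\<in>{1..n}. zeta_weight s (i - 1))"
      by (intro sum_mono *)
    also have "\<dots> = (\<Sum>i<n. zeta_weight s i)"
      by (rule sum.reindex_bij_witness[of _ Suc "\<lambda>i. i - 1"]) auto
    also have "\<dots> \<le> (\<Sum>k. zeta_weight s k)"
      using summable_zeta_weight[OF \<open>s > 1\<close>] zeta_weight_pos by (intro sum_le_suminf) (auto simp: less_imp_le)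
    finally have "harm n / 2 \<le> (\<Sum>k. zeta_weight s k)" .
    moreover have "(harm n :: real) > 0" using \<open>n > 0\<close> by (intro harm_pos)
    ultimately have "1 / (\<Sum>k. zeta_weight s k) \<le> 1 / (harm n / 2)"
      using suminf_zeta_weight_pos[OF \<open>s > 1\<close>] by (intro divide_left_mono mult_pos_pos) auto
    then show ?thesis
      using pmf_zeta[OF \<open>s > 1\<close>, of 0] suminf_zeta_weight_pos[OF \<open>s > 1\<close>]
      by (simp add: zeta_weight_def n_def s_def)
  qed
  then show "\<forall>\<^sub>F k in sequentially. norm (pmf (zeta_pmf (1 + 1 / real (Suc k))) 0) \<le> 2 / harm (Suc k)"
    by simp
qed

text \<open>Unnormalized weight of \<open>M\<close>; extended nonnegative values make rearrangements free.\<close>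
definition zeta_sum :: "real \<Rightarrow> nat set \<Rightarrow> ennreal" where
  "zeta_sum s M = (\<integral>\<^sup>+k. ennreal (zeta_weight s k) * indicator M (Suc k) \<partial>count_space UNIV)"

lemma zeta_sum_UNIV: "s > 1 \<Longrightarrow> zeta_sum s UNIV = ennreal (\<Sum>k. zeta_weight s k)"
  using summable_zeta_weight[of s] zeta_weight_pos unfolding zeta_sum_def nn_integral_count_space_nat
  by (simp add: suminf_ennreal2 less_imp_le)

lemma zeta_sum_eq_pmf:
  assumes s: "s > 1"
  shows "zeta_sum s M = zeta_sum s UNIV * emeasure (measure_pmf (zeta_pmf s)) {k. Suc k \<in> M}"
proof -
  have "zeta_sum s UNIV * emeasure (measure_pmf (zeta_pmf s)) {k. Suc k \<in> M} =
      zeta_sum s UNIV * (\<integral>\<^sup>+k. ennreal (pmf (zeta_pmf s) k) * indicator {k. Suc k \<in> M} k \<partial>count_space UNIV)"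
    by (simp add: nn_integral_pmf[symmetric] nn_integral_count_space_indicator)
  also have "\<dots> = (\<integral>\<^sup>+k. zeta_sum s UNIV * (ennreal (pmf (zeta_pmf s) k) * indicator {k. Suc k \<in> M} k) \<partial>count_space UNIV)"
    by (rule nn_integral_cmult[symmetric]) simp
  also have "\<dots> = zeta_sum s M"
    unfolding zeta_sum_def[of s M]
  proof (intro nn_integral_cong)
    fix k
    have "zeta_sum s UNIV * ennreal (pmf (zeta_pmf s) k) = ennreal (zeta_weight s k)"
      using suminf_zeta_weight_pos[OF s] zeta_weight_pos[of s k]
      by (simp add: zeta_sum_UNIV[OF s] pmf_zeta[OF s] ennreal_mult[symmetric])
    then show "zeta_sum s UNIV * (ennreal (pmf (zeta_pmf s) k) * indicator {k. Suc k \<in> M} k) =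
        ennreal (zeta_weight s k) * indicator M (Suc k)"
      by (simp add: mult.assoc[symmetric] indicator_def)
  qed
  finally show ?thesis by simp
qed

text \<open>Since \<open>n powr - t = n powr - s * n powr (s - t)\<close> and \<open>n powr (s - t)\<close> is the sum of Jordan's totient \<open>J d\<close>
  over the divisors \<open>d\<close> of \<open>n\<close>, the weight with exponent \<open>t\<close> is the Dirichlet convolution of the weight with
  exponent \<open>s\<close> and the nonnegative weight \<open>J d * d powr - s\<close>: sum over \<open>n = d * e\<close> with \<open>d = Suc i\<close>.\<close>
lemma zeta_sum_convolution:
  assumes "t \<le> s"
  shows "zeta_sum t M = (\<integral>\<^sup>+i. ennreal (zeta_weight s i * jordan_totient (s - t) (Suc i)) *
     zeta_sum s {e. Suc i * e \<in> M} \<partial>count_space UNIV)"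
proof -
  define J where "J = jordan_totient (s - t)"
  have J: "J n \<ge> 0" for n unfolding J_def using assms by (intro jordan_totient_nonneg) simp
  \<comment> \<open>the contribution of the factorization \<open>Suc k = Suc i * e\<close>\<close>
  define h where "h k i = (if Suc i dvd Suc k then ennreal (zeta_weight s k * J (Suc i)) * indicator M (Suc k) else 0)"
    for k i :: nat
  have "zeta_sum t M = (\<integral>\<^sup>+k. \<integral>\<^sup>+i. h k i \<partial>count_space UNIV \<partial>count_space UNIV)"
    unfolding zeta_sum_def
  proof (intro nn_integral_cong)
    fix k
    have "zeta_weight t k = zeta_weight s k * real (Suc k) powr (s - t)"
      unfolding zeta_weight_def by (simp add: powr_add[symmetric])
    also have "real (Suc k) powr (s - t) = (\<Sum>d | d dvd Suc k. J d)"
      unfolding J_def by (rule sum_divisors_jordan_totient[symmetric]) simp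
    also have "\<dots> = (\<Sum>i | Suc i dvd Suc k. J (Suc i))"
    proof (rule sum.reindex_bij_witness[of _ Suc "\<lambda>i. i - 1"])
      fix d assume "d \<in> {d. d dvd Suc k}"
      then have "Suc (d - 1) = d" by (cases d) auto
      then show "Suc (d - 1) = d" "J (Suc (d - 1)) = J d" "d - 1 \<in> {i. Suc i dvd Suc k}"
        using \<open>d \<in> _\<close> by auto
    qed auto
    finally have "ennreal (zeta_weight t k) * indicator M (Suc k) =
        (\<Sum>i | Suc i dvd Suc k. ennreal (zeta_weight s k * J (Suc i))) * indicator M (Suc k)"
      using J zeta_weight_pos[of s k] by (simp add: sum_distrib_left less_imp_le)
    also have "\<dots> = (\<Sum>i | Suc i dvd Suc k. h k i)"
      unfolding sum_distrib_right by (intro sum.cong) (auto simp: h_def)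
    also have "\<dots> = (\<integral>\<^sup>+i. h k i \<partial>count_space UNIV)"
    proof (rule nn_integral_count_space'[symmetric])
      show "finite {i. Suc i dvd Suc k}"
        by (rule finite_subset[of _ "{..k}"]) (auto dest: dvd_imp_le)
    qed (auto simp: h_def)
    finally show "ennreal (zeta_weight t k) * indicator M (Suc k) = (\<integral>\<^sup>+i. h k i \<partial>count_space UNIV)" .
  qed
  also have "\<dots> = (\<integral>\<^sup>+i. \<integral>\<^sup>+k. h k i \<partial>count_space UNIV \<partial>count_space UNIV)"
    by (rule nn_integral_count_space_nn_integral) auto
  also have "\<dots> = (\<integral>\<^sup>+i. ennreal (zeta_weight s i * J (Suc i)) *
     zeta_sum s {e. Suc i * e \<in> M} \<partial>count_space UNIV)"
  proof (intro nn_integral_cong)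
    fix i
    let ?S = "{k. Suc i dvd Suc k}" and ?f = "\<lambda>j. Suc i * Suc j - 1"
    have bij: "bij_betw ?f UNIV ?S"
    proof (rule bij_betwI')
      fix x y show "(?f x = ?f y) = (x = y)" by (auto simp del: mult_Suc)
    next
      fix x show "?f x \<in> ?S" by (simp del: mult_Suc mult_Suc_right)
    next
      fix k assume "k \<in> ?S"
      then obtain c where c: "Suc k = Suc i * c" by (auto simp: dvd_def)
      then obtain j where "c = Suc j" by (cases c) auto
      with c show "\<exists>x\<in>UNIV. k = ?f x" by (metis UNIV_I diff_Suc_1)
    qed
    have "(\<integral>\<^sup>+k. h k i \<partial>count_space UNIV) = (\<integral>\<^sup>+k. h k i \<partial>count_space ?S)"
      by (rule nn_integral_count_space_eq) (auto simp: h_def)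
    also have "\<dots> = (\<integral>\<^sup>+j. h (?f j) i \<partial>count_space UNIV)"
      by (rule nn_integral_bij_count_space[OF bij, symmetric])
    also have "\<dots> = (\<integral>\<^sup>+j. ennreal (zeta_weight s i * J (Suc i)) *
        (ennreal (zeta_weight s j) * indicator {e. Suc i * e \<in> M} (Suc j)) \<partial>count_space UNIV)"
    proof (intro nn_integral_cong)
      fix j
      have S: "Suc (?f j) = Suc i * Suc j" by simp
      have "zeta_weight s (?f j) = zeta_weight s i * zeta_weight s j"
        unfolding zeta_weight_def S of_nat_mult by (rule powr_mult)
      then have "ennreal (zeta_weight s (?f j) * J (Suc i)) =
          ennreal (zeta_weight s i * J (Suc i)) * ennreal (zeta_weight s j)"
        using J[of "Suc i"] zeta_weight_pos[of s i] zeta_weight_pos[of s j]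
        by (simp add: ennreal_mult[symmetric] less_imp_le mult_ac)
      then show "h (?f j) i = ennreal (zeta_weight s i * J (Suc i)) *
        (ennreal (zeta_weight s j) * indicator {e. Suc i * e \<in> M} (Suc j))"
        unfolding h_def S by (simp add: mult_ac indicator_def del: mult_Suc mult_Suc_right)
    qed
    also have "\<dots> = ennreal (zeta_weight s i * J (Suc i)) * zeta_sum s {e. Suc i * e \<in> M}"
      unfolding zeta_sum_def by (rule nn_integral_cmult) simp
    finally show "(\<integral>\<^sup>+k. h k i \<partial>count_space UNIV) =
      ennreal (zeta_weight s i * J (Suc i)) * zeta_sum s {e. Suc i * e \<in> M}" .
  qed
  finally show ?thesis by (simp add: J_def)
qed

text \<open>By \<open>zeta_sum_convolution\<close> a random integer with exponent \<open>t\<close> is distributed like \<open>d * e\<close> with \<open>d\<close> and \<open>e\<close>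
  independent and \<open>e\<close> of exponent \<open>s\<close>. If \<open>e\<close> lies in the set \<open>M\<close> of multiples, then so does \<open>d * e\<close>.\<close>
lemma zeta_pmf_multiples_antimono:
  assumes "1 < t" "t \<le> s" and M: "\<And>m n. m \<in> M \<Longrightarrow> m dvd n \<Longrightarrow> n \<in> M"
  shows "measure (measure_pmf (zeta_pmf s)) {k. Suc k \<in> M} \<le> measure (measure_pmf (zeta_pmf t)) {k. Suc k \<in> M}"
proof -
  define c where "c i = ennreal (zeta_weight s i * jordan_totient (s - t) (Suc i))" for i
  define H where "H = (\<integral>\<^sup>+i. c i \<partial>count_space UNIV)"
  let ?Es = "emeasure (measure_pmf (zeta_pmf s)) {k. Suc k \<in> M}"
  let ?Et = "emeasure (measure_pmf (zeta_pmf t)) {k. Suc k \<in> M}"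
  have s: "1 < s" using assms by simp
  \<comment> \<open>\<open>H\<close> is the total weight of the cofactor \<open>d\<close>\<close>
  have U: "zeta_sum t UNIV = H * zeta_sum s UNIV"
    unfolding H_def by (subst nn_integral_multc[symmetric]) (simp_all add: zeta_sum_convolution[OF assms(2)] c_def)
  have "H * zeta_sum s M = (\<integral>\<^sup>+i. c i * zeta_sum s M \<partial>count_space UNIV)"
    unfolding H_def by (subst nn_integral_multc[symmetric]) simp_all
  also have "\<dots> \<le> (\<integral>\<^sup>+i. c i * zeta_sum s {e. Suc i * e \<in> M} \<partial>count_space UNIV)"
    unfolding zeta_sum_def
    by (intro nn_integral_mono mult_left_mono)
      (auto simp: indicator_def simp del: mult_Suc mult_Suc_right intro: M[OF _ dvd_triv_right])
  also have "\<dots> = zeta_sum t M"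
    by (simp only: zeta_sum_convolution[OF assms(2)] c_def)
  finally have "H * zeta_sum s M \<le> zeta_sum t M" .
  then have "zeta_sum t UNIV * ?Es \<le> zeta_sum t UNIV * ?Et"
    using zeta_sum_eq_pmf[OF s, of M] zeta_sum_eq_pmf[OF assms(1), of M] by (simp add: U mult_ac)
  then have "?Es \<le> ?Et"
    using zeta_sum_UNIV[OF assms(1)] suminf_zeta_weight_pos[OF assms(1)]
    by (subst (asm) ennreal_mult_le_mult_iff) auto
  then show ?thesis by (simp add: measure_pmf.emeasure_eq_measure)
qed

section \<open>The group of residues and its Haar measure\<close>

definition residues_of :: "nat set \<Rightarrow> int \<Rightarrow> nat \<Rightarrow> int" where
  "residues_of B n = (\<lambda>b\<in>B. n mod int b)"

definition G_top :: "nat set \<Rightarrow> (nat \<Rightarrow> int) topology" where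
  "G_top B = subtopology (residue_top B) (G_set B)"

definition rotate_G :: "nat set \<Rightarrow> (nat \<Rightarrow> int) \<Rightarrow> (nat \<Rightarrow> int) \<Rightarrow> nat \<Rightarrow> int" where
  "rotate_G B h g = (\<lambda>b\<in>B. (h b + g b) mod int b)"

abbreviation rotate_one :: "nat set \<Rightarrow> (nat \<Rightarrow> int) \<Rightarrow> nat \<Rightarrow> int" where
  "rotate_one B \<equiv> rotate_G B (residues_of B 1)"

text \<open>Every point of \<open>G\<close> agrees with an integer at any finite number of moduli, so these sets cover \<open>G\<close> at each
  level \<open>j\<close>; they are the cosets of a finite-index subgroup.\<close>
definition cylinder :: "nat set \<Rightarrow> nat \<Rightarrow> int \<Rightarrow> (nat \<Rightarrow> int) set" where
  "cylinder B j n = {g \<in> G_set B. \<forall>b\<in>B. b \<le> j \<longrightarrow> g b = n mod int b}"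

lemma rotate_G_residues_of: "rotate_G B (residues_of B m) (residues_of B n) = residues_of B (m + n)"
  by (auto simp: rotate_G_def residues_of_def restrict_def mod_simps)

lemma rotate_G_commute: "rotate_G B h (rotate_G B k g) = rotate_G B k (rotate_G B h g)"
  by (auto simp: rotate_G_def restrict_def mod_simps algebra_simps)

lemma cylinder_cong: "(\<And>b. b \<in> B \<Longrightarrow> b \<le> j \<Longrightarrow> m mod int b = n mod int b) \<Longrightarrow> cylinder B j m = cylinder B j n"
  by (auto simp: cylinder_def)

lemma cylinder_eq_if_meet:
  assumes "g \<in> cylinder B i m" "g \<in> cylinder B j n" "i \<le> j"
  shows "cylinder B j n \<subseteq> cylinder B i m"
  using assms by (auto simp: cylinder_def)

context
  fixes B :: "nat set"
  assumes B: "0 \<notin> B"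
begin

lemma B_pos: "b \<in> B \<Longrightarrow> 0 < b"
  using B by (cases b) auto

lemma carrier_residue: "b \<in> B \<Longrightarrow> carrier (integer_mod_group b) = {0..<int b}"
  using B_pos[of b] by (auto simp: integer_mod_group_def)

lemma topspace_residue_top: "topspace (residue_top B) = (\<Pi>\<^sub>E b\<in>B. {0..<int b})"
  by (auto simp: residue_top_def carrier_residue intro!: PiE_cong)

lemma continuous_map_residue_coord:
  "b \<in> B \<Longrightarrow> continuous_map (residue_top B) (discrete_topology {0..<int b}) (\<lambda>g. g b)"
  unfolding residue_top_def using continuous_map_product_projection[of b B "\<lambda>b. discrete_topology (carrier (integer_mod_group b))"]
  by (simp add: carrier_residue)

lemma residue_coord_clopen:
  assumes "b \<in> B"
  shows "{g \<in> topspace (residue_top B). P (g b)} \<in> clopens (residue_top B)"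
proof -
  have "(\<lambda>g. g b) -` ({0..<int b} \<inter> {r. P r}) \<inter> topspace (residue_top B) \<in> clopens (residue_top B)"
    by (rule clopens_vimage[OF continuous_map_residue_coord[OF assms] clopens_discrete]) auto
  also have "(\<lambda>g. g b) -` ({0..<int b} \<inter> {r. P r}) \<inter> topspace (residue_top B) = {g \<in> topspace (residue_top B). P (g b)}"
    using assms by (auto simp: topspace_residue_top PiE_iff extensional_def)
  finally show ?thesis .
qed

text \<open>The closure of the integers in the product consists of the consistent residue systems: finitely many
  coordinates always come from one integer. The moduli up to \<open>j\<close> stand for an arbitrary finite set of moduli.\<close>
lemma G_set_iff:
  "g \<in> G_set B \<longleftrightarrow> g \<in> extensional B \<and> (\<forall>j. \<exists>n. \<forall>b\<in>B. b \<le> j \<longrightarrow> g b = n mod int b)"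
proof
  assume g: "g \<in> G_set B"
  then have gt: "g \<in> topspace (residue_top B)"
    unfolding G_set_def by (meson closure_of_subset_topspace subsetD)
  have "\<exists>n. \<forall>b\<in>B. b \<le> j \<longrightarrow> g b = n mod int b" for j
  proof -
    let ?U = "{h \<in> topspace (residue_top B). \<forall>b\<in>B \<inter> {..j}. h b = g b}"
    have "?U \<in> clopens (residue_top B)"
      by (rule clopens_ball) (auto intro!: residue_coord_clopen)
    then have "openin (residue_top B) ?U" by (auto simp: clopens_def)
    moreover have "g \<in> ?U" using gt by auto
    ultimately have "\<exists>h. h \<in> range (\<lambda>n. \<lambda>b\<in>B. n mod int b) \<and> h \<in> ?U"
      using g[unfolded G_set_def in_closure_of, THEN conjunct2, rule_format, of ?U] by simp
    then obtain n where "(\<lambda>b\<in>B. n mod int b) \<in> ?U" by auto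
    then have "\<forall>b\<in>B. b \<le> j \<longrightarrow> g b = n mod int b" by simp
    then show ?thesis by blast
  qed
  then show "g \<in> extensional B \<and> (\<forall>j. \<exists>n. \<forall>b\<in>B. b \<le> j \<longrightarrow> g b = n mod int b)"
    using gt by (auto simp: topspace_residue_top PiE_def)
next
  assume g: "g \<in> extensional B \<and> (\<forall>j. \<exists>n. \<forall>b\<in>B. b \<le> j \<longrightarrow> g b = n mod int b)"
  have gt: "g \<in> topspace (residue_top B)"
    unfolding topspace_residue_top
  proof (rule PiE_I)
    fix b assume "b \<in> B"
    moreover obtain n where "\<forall>c\<in>B. c \<le> b \<longrightarrow> g c = n mod int c" using g by blast
    ultimately show "g b \<in> {0..<int b}" using B_pos[of b] by auto
  qed (use g in \<open>auto simp: extensional_def\<close>)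
  show "g \<in> G_set B"
    unfolding G_set_def in_closure_of
  proof (intro conjI allI impI gt)
    fix U assume U: "g \<in> U \<and> openin (residue_top B) U"
    then obtain V where V: "finite {b \<in> B. V b \<noteq> carrier (integer_mod_group b)}" "g \<in> Pi\<^sub>E B V" "Pi\<^sub>E B V \<subseteq> U"
      unfolding residue_top_def openin_product_topology_alt by (auto; metis)
    then obtain j where j: "\<And>b. b \<in> B \<Longrightarrow> V b \<noteq> carrier (integer_mod_group b) \<Longrightarrow> b \<le> j"
      using finite_nat_set_iff_bounded_le[THEN iffD1, OF V(1)] by blast
    obtain n where n: "\<And>b. b \<in> B \<Longrightarrow> b \<le> j \<Longrightarrow> g b = n mod int b" using g by blast
    have "residues_of B n \<in> Pi\<^sub>E B V"
    proof (rule PiE_I)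
      fix b assume b: "b \<in> B"
      show "residues_of B n b \<in> V b"
      proof (cases "b \<le> j")
        case True
        then show ?thesis using n[OF b] V(2) b by (auto simp: residues_of_def PiE_iff)
      next
        case False
        then have "V b = {0..<int b}" using j[OF b] carrier_residue[OF b] by blast
        then show ?thesis using B_pos[OF b] b by (simp add: residues_of_def)
      qed
    qed (auto simp: residues_of_def)
    then have "residues_of B n \<in> U" using V(3) by blast
    then show "\<exists>y. y \<in> range (\<lambda>n. \<lambda>b\<in>B. n mod int b) \<and> y \<in> U"
      by (intro exI[of _ "residues_of B n"]) (simp add: residues_of_def)
  qed
qed

lemma G_set_subset: "G_set B \<subseteq> topspace (residue_top B)"
  unfolding G_set_def by (rule closure_of_subset_topspace)

lemma topspace_G_top [simp]: "topspace (G_top B) = G_set B"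
  using G_set_subset by (auto simp: G_top_def)

lemma compact_G_top: "compact_space (G_top B)"
proof -
  have "compact_space (residue_top B)"
    unfolding residue_top_def compact_space_product_topology
    by (intro disjI2 ballI) (simp add: compact_space_discrete_topology carrier_residue)
  then have "compactin (residue_top B) (G_set B)"
    unfolding G_set_def by (intro closedin_compact_space closedin_closure_of)
  then show ?thesis unfolding G_top_def by (rule compactin_subspace[THEN iffD1, THEN conjunct2])
qed

lemma G_coord_clopen:
  assumes "b \<in> B"
  shows "{g \<in> G_set B. P (g b)} \<in> clopens (G_top B)"
proof -
  have "id -` {g \<in> topspace (residue_top B). P (g b)} \<inter> topspace (G_top B) \<in> clopens (G_top B)"
    by (rule clopens_vimage[OF _ residue_coord_clopen[OF assms]]) (simp add: G_top_def continuous_map_from_subtopology)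
  also have "id -` {g \<in> topspace (residue_top B). P (g b)} \<inter> topspace (G_top B) = {g \<in> G_set B. P (g b)}"
    using G_set_subset by auto
  finally show ?thesis .
qed

lemma residues_of_in_G: "residues_of B n \<in> G_set B"
  unfolding G_set_iff by (auto simp: residues_of_def intro!: exI[of _ n])

lemma cylinder_clopen: "cylinder B j n \<in> clopens (G_top B)"
proof -
  have "{g \<in> topspace (G_top B). \<forall>b\<in>B \<inter> {..j}. g b = n mod int b} \<in> clopens (G_top B)"
    by (rule clopens_ball) (auto intro!: G_coord_clopen)
  also have "{g \<in> topspace (G_top B). \<forall>b\<in>B \<inter> {..j}. g b = n mod int b} = cylinder B j n"
    by (auto simp: cylinder_def)
  finally show ?thesis .
qed

lemma openin_G_top_cylinder:
  assumes "openin (G_top B) U" "g \<in> U"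
  obtains j n where "g \<in> cylinder B j n" "cylinder B j n \<subseteq> U"
proof -
  obtain W where W: "openin (residue_top B) W" "U = W \<inter> G_set B"
    using assms(1) by (auto simp: G_top_def openin_subtopology)
  then obtain V where V: "finite {b \<in> B. V b \<noteq> carrier (integer_mod_group b)}" "g \<in> Pi\<^sub>E B V" "Pi\<^sub>E B V \<subseteq> W"
    using assms(2) unfolding residue_top_def openin_product_topology_alt by (auto; metis)
  then obtain j where j: "\<And>b. b \<in> B \<Longrightarrow> V b \<noteq> carrier (integer_mod_group b) \<Longrightarrow> b \<le> j"
    using finite_nat_set_iff_bounded_le[THEN iffD1, OF V(1)] by blast
  have g: "g \<in> G_set B" using W assms by auto
  then obtain n where n: "\<And>b. b \<in> B \<Longrightarrow> b \<le> j \<Longrightarrow> g b = n mod int b" unfolding G_set_iff by blast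
  have "h \<in> Pi\<^sub>E B V" if h: "h \<in> cylinder B j n" for h
  proof (rule PiE_I)
    have hG: "h \<in> (\<Pi>\<^sub>E b\<in>B. {0..<int b})" using h G_set_subset by (auto simp: cylinder_def topspace_residue_top)
    then show "h b = undefined" if "b \<notin> B" for b using that by auto
    fix b assume b: "b \<in> B"
    show "h b \<in> V b"
    proof (cases "b \<le> j")
      case True
      then have "h b = g b" using h b n by (simp add: cylinder_def)
      then show ?thesis using V(2) b by auto
    next
      case False
      then have "V b = {0..<int b}" using j[OF b] carrier_residue[OF b] by blast
      then show ?thesis using hG b by auto
    qed
  qed
  moreover have "g \<in> cylinder B j n" using g n by (auto simp: cylinder_def)
  ultimately show ?thesis using W V by (intro that[of j n]) (auto simp: cylinder_def subset_iff)
qed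

text \<open>There are only countably many cylinders and they form a base, so open sets, clopen sets and cylinders
  generate the same sigma-algebra.\<close>
lemma sigma_sets_cylinder:
  "sets (clopen_sigma (G_top B)) = sigma_sets (G_set B) (range (case_prod (cylinder B)))"
  "sets (sigma (G_set B) {U. openin (G_top B) U}) = sets (clopen_sigma (G_top B))"
proof -
  let ?C = "range (case_prod (cylinder B))"
  have 1: "?C \<subseteq> clopens (G_top B)" using cylinder_clopen by auto
  have 2: "clopens (G_top B) \<subseteq> {U. openin (G_top B) U}" by (auto simp: clopens_def)
  have 3: "{U. openin (G_top B) U} \<subseteq> sigma_sets (G_set B) ?C"
  proof clarify
    fix U assume U: "openin (G_top B) U"
    let ?D = "{c \<in> ?C. c \<subseteq> U}"
    have "U = \<Union>?D"
    proof (intro equalityI subsetI)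
      fix g assume "g \<in> U"
      then obtain j n where "g \<in> cylinder B j n" "cylinder B j n \<subseteq> U" using openin_G_top_cylinder[OF U] by blast
      then show "g \<in> \<Union>?D" by (intro UnionI[of "cylinder B j n"]) auto
    qed auto
    moreover have "countable ?D" by (rule countable_subset[of _ ?C]) auto
    ultimately show "U \<in> sigma_sets (G_set B) ?C"
      by (metis (no_types, lifting) mem_Collect_eq sigma_sets.Basic sigma_sets_UNION)
  qed
  have s: "sets (clopen_sigma (G_top B)) = sigma_sets (G_set B) (clopens (G_top B))"
    by (simp add: sets_clopen_sigma)
  have o: "sets (sigma (G_set B) {U. openin (G_top B) U}) = sigma_sets (G_set B) {U. openin (G_top B) U}"
    by (rule sets_measure_of) (auto dest!: openin_subset)
  have "sigma_sets (G_set B) ?C \<subseteq> sigma_sets (G_set B) (clopens (G_top B))"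
    using 1 by (rule sigma_sets_mono')
  moreover have "sigma_sets (G_set B) (clopens (G_top B)) \<subseteq> sigma_sets (G_set B) {U. openin (G_top B) U}"
    using 2 by (rule sigma_sets_mono')
  moreover have "sigma_sets (G_set B) {U. openin (G_top B) U} \<subseteq> sigma_sets (G_set B) ?C"
    using 3 by (rule sigma_sets_mono)
  ultimately show "sets (clopen_sigma (G_top B)) = sigma_sets (G_set B) ?C"
    "sets (sigma (G_set B) {U. openin (G_top B) U}) = sets (clopen_sigma (G_top B))"
    unfolding s o by auto
qed

lemma rotate_G_in_G:
  assumes "h \<in> G_set B" "g \<in> G_set B"
  shows "rotate_G B h g \<in> G_set B"
  unfolding G_set_iff
proof (intro conjI allI)
  show "rotate_G B h g \<in> extensional B" by (simp add: rotate_G_def)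
  fix j
  obtain m where "\<forall>b\<in>B. b \<le> j \<longrightarrow> h b = m mod int b" using assms(1) unfolding G_set_iff by blast
  moreover obtain n where "\<forall>b\<in>B. b \<le> j \<longrightarrow> g b = n mod int b" using assms(2) unfolding G_set_iff by blast
  ultimately show "\<exists>n. \<forall>b\<in>B. b \<le> j \<longrightarrow> rotate_G B h g b = n mod int b"
    by (intro exI[of _ "m + n"]) (simp add: rotate_G_def mod_simps)
qed

lemma G_neg:
  assumes "h \<in> G_set B"
  shows "(\<lambda>b\<in>B. (- h b) mod int b) \<in> G_set B"
  unfolding G_set_iff
proof (intro conjI allI)
  fix j
  obtain m where "\<forall>b\<in>B. b \<le> j \<longrightarrow> h b = m mod int b" using assms(1) unfolding G_set_iff by blast
  then show "\<exists>n. \<forall>b\<in>B. b \<le> j \<longrightarrow> (\<lambda>b\<in>B. (- h b) mod int b) b = n mod int b"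
    by (intro exI[of _ "- m"]) (simp add: mod_simps)
qed simp

lemma rotate_G_neg_cancel:
  assumes "g \<in> G_set B"
  shows "rotate_G B h (rotate_G B (\<lambda>b\<in>B. (- h b) mod int b) g) = g"
    "rotate_G B (\<lambda>b\<in>B. (- h b) mod int b) (rotate_G B h g) = g"
proof -
  have "g \<in> (\<Pi>\<^sub>E b\<in>B. {0..<int b})" using assms G_set_subset by (auto simp: topspace_residue_top)
  then have 1: "b \<in> B \<Longrightarrow> g b mod int b = g b" and 2: "b \<notin> B \<Longrightarrow> g b = undefined" for b
    by (auto simp: PiE_iff extensional_def)
  have "rotate_G B h (rotate_G B (\<lambda>b\<in>B. (- h b) mod int b) g) b = g b"
    "rotate_G B (\<lambda>b\<in>B. (- h b) mod int b) (rotate_G B h g) b = g b" for b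
    using 1[of b] 2[of b] by (cases "b \<in> B"; simp add: rotate_G_def mod_simps)+
  then show "rotate_G B h (rotate_G B (\<lambda>b\<in>B. (- h b) mod int b) g) = g"
    "rotate_G B (\<lambda>b\<in>B. (- h b) mod int b) (rotate_G B h g) = g"
    by auto
qed

lemma continuous_rotate_G:
  assumes h: "h \<in> G_set B"
  shows "continuous_map (G_top B) (G_top B) (rotate_G B h)"
proof -
  have "continuous_map (G_top B) (residue_top B) (rotate_G B h)"
    unfolding residue_top_def continuous_map_componentwise
  proof (intro conjI ballI)
    show "rotate_G B h ` topspace (G_top B) \<subseteq> extensional B" by (auto simp: rotate_G_def)
    fix b assume b: "b \<in> B"
    have "continuous_map (G_top B) (discrete_topology {0..<int b}) (\<lambda>g. g b)"
      unfolding G_top_def by (intro continuous_map_from_subtopology continuous_map_residue_coord b)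
    moreover have "continuous_map (discrete_topology {0..<int b}) (discrete_topology {0..<int b}) (\<lambda>r. (h b + r) mod int b)"
      using B_pos[OF b] by (auto simp: continuous_map_from_discrete_topology)
    ultimately have "continuous_map (G_top B) (discrete_topology {0..<int b}) ((\<lambda>r. (h b + r) mod int b) \<circ> (\<lambda>g. g b))"
      by (rule continuous_map_compose)
    then show "continuous_map (G_top B) (discrete_topology (carrier (integer_mod_group b))) (\<lambda>x. rotate_G B h x b)"
      using b by (simp add: carrier_residue rotate_G_def o_def)
  qed
  then show ?thesis
    using rotate_G_in_G[OF h] by (simp add: G_top_def continuous_map_in_subtopology image_subset_iff)
qed

lemma rotate_one_vimage_cylinder: "rotate_one B -` cylinder B j n \<inter> G_set B = cylinder B j (n - 1)"
proof -
  have "((1 mod int b + g) mod int b = n mod int b) \<longleftrightarrow> (g mod int b = (n - 1) mod int b)" for b g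
    by (simp add: mod_simps mod_eq_dvd_iff algebra_simps)
  moreover have "g b mod int b = g b" if "g \<in> G_set B" "b \<in> B" for g b
    using that G_set_subset by (force simp: topspace_residue_top PiE_iff)
  ultimately show ?thesis
    using rotate_G_in_G[OF residues_of_in_G[of 1]] by (auto simp: cylinder_def rotate_G_def residues_of_def)
qed

lemma finite_range_cylinder: "finite (range (cylinder B j))"
proof -
  define L where "L = int (\<Prod>b\<in>B \<inter> {..j}. b)"
  have "L > 0" unfolding L_def using B_pos by (auto intro!: prod_pos simp del: of_nat_prod)
  have "cylinder B j n = cylinder B j (n mod L)" for n
  proof (rule cylinder_cong)
    fix b assume "b \<in> B" "b \<le> j"
    then have "b dvd (\<Prod>b\<in>B \<inter> {..j}. b)" by (intro dvd_prodI) auto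
    then have "int b dvd L" unfolding L_def by (simp only: int_dvd_int_iff)
    then show "n mod int b = n mod L mod int b" by (simp add: mod_mod_cancel)
  qed
  moreover have "n mod L \<in> {0..<L}" for n using \<open>L > 0\<close> by simp
  ultimately have "range (cylinder B j) \<subseteq> cylinder B j ` {0..<L}" by blast
  then show ?thesis by (rule finite_subset) auto
qed

text \<open>At a given level the cylinders partition \<open>G\<close> into finitely many sets, and the rotation moves
  \<open>cylinder B j (n - 1)\<close> onto \<open>cylinder B j n\<close>, so all of them have the same mass.\<close>
lemma measure_cylinder:
  assumes P: "prob_space P" "sets P = sets (clopen_sigma (G_top B))"
    and inv: "distr P (clopen_sigma (G_top B)) (rotate_one B) = P"
  shows "measure P (cylinder B j n) = 1 / real (card (range (cylinder B j)))"
proof -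
  interpret prob_space P by fact
  have sp: "space P = G_set B" using sets_eq_imp_space_eq[OF P(2)] by simp
  have T: "rotate_one B \<in> measurable P (clopen_sigma (G_top B))"
    using measurable_continuous_clopen_sigma[OF continuous_rotate_G[OF residues_of_in_G]] measurable_cong_sets[OF P(2) refl] by blast
  have cs: "cylinder B j n \<in> sets P" for n by (simp add: P(2) clopens_in_sets cylinder_clopen)
  have step: "measure P (cylinder B j (n - 1)) = measure P (cylinder B j n)" for n
  proof -
    have "measure P (cylinder B j n) = measure (distr P (clopen_sigma (G_top B)) (rotate_one B)) (cylinder B j n)"
      by (simp add: inv)
    also have "\<dots> = measure P (cylinder B j (n - 1))"
      using T cs by (subst measure_distr) (simp_all add: P(2) sp rotate_one_vimage_cylinder)
    finally show ?thesis ..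
  qed
  have const: "measure P (cylinder B j n) = measure P (cylinder B j 0)" for n
  proof (induction n rule: int_induct[where k = 0])
    case (step1 i) then show ?case using step[of "i + 1"] by simp
  next
    case (step2 i) then show ?case using step[of i] by simp
  qed simp
  have "G_set B = \<Union>(range (cylinder B j))" by (auto simp: cylinder_def G_set_iff)
  then have "1 = measure P (\<Union>C\<in>range (cylinder B j). C)" using prob_space sp by simp
  also have "\<dots> = (\<Sum>C\<in>range (cylinder B j). measure P C)"
  proof (rule finite_measure_finite_Union[OF finite_range_cylinder])
    show "disjoint_family_on (\<lambda>C. C) (range (cylinder B j))"
      unfolding disjoint_family_on_def using cylinder_eq_if_meet[of _ _ j _ j] by blast
  qed (use cs in auto)
  also have "\<dots> = (\<Sum>C\<in>range (cylinder B j). measure P (cylinder B j 0))"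
    by (rule sum.cong) (use const in auto)
  also have "\<dots> = real (card (range (cylinder B j))) * measure P (cylinder B j 0)" by simp
  finally have *: "real (card (range (cylinder B j))) * measure P (cylinder B j 0) = 1" by simp
  then have "real (card (range (cylinder B j))) \<noteq> 0" by (metis mult_zero_left zero_neq_one)
  with * show ?thesis using const[of n] by (simp add: field_simps)
qed

text \<open>Invariance forces the masses of cylinders, and any two cylinders are disjoint or nested, so that together with
  the empty set they form a generator closed under intersections.\<close>
lemma odometer_invariant_unique:
  assumes "prob_space P" "sets P = sets (clopen_sigma (G_top B))" "distr P (clopen_sigma (G_top B)) (rotate_one B) = P"
    and "prob_space Q" "sets Q = sets (clopen_sigma (G_top B))" "distr Q (clopen_sigma (G_top B)) (rotate_one B) = Q"
  shows "P = Q"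
proof (rule measure_eqI_generator_eq)
  interpret P: prob_space P by fact
  interpret Q: prob_space Q by fact
  let ?E = "insert {} (range (case_prod (cylinder B)))"
  have "cylinder B i m \<inter> cylinder B j n \<in> ?E" if "i \<le> j" for i j m n
  proof (cases "cylinder B i m \<inter> cylinder B j n = {}")
    case False
    then have "cylinder B j n \<subseteq> cylinder B i m" using cylinder_eq_if_meet that by blast
    then have "cylinder B i m \<inter> cylinder B j n = case_prod (cylinder B) (j, n)" by auto
    then show ?thesis by blast
  qed auto
  then have "cylinder B i m \<inter> cylinder B j n \<in> ?E" for i j m n
    by (metis inf_commute nle_le)
  then show "Int_stable ?E" unfolding Int_stable_def by force
  show "?E \<subseteq> Pow (G_set B)" by (auto simp: cylinder_def)
  show "emeasure P A = emeasure Q A" if "A \<in> ?E" for A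
    using that measure_cylinder[OF assms(1-3)] measure_cylinder[OF assms(4-6)]
    by (auto simp: P.emeasure_eq_measure Q.emeasure_eq_measure)
  have "sigma_sets (G_set B) ?E = sigma_sets (G_set B) (range (case_prod (cylinder B)))"
    by (intro equalityI sigma_sets_mono) (auto intro: sigma_sets.intros)
  then show "sets P = sigma_sets (G_set B) ?E" "sets Q = sigma_sets (G_set B) ?E"
    using assms sigma_sets_cylinder(1) by simp_all
  show "range (\<lambda>_. cylinder B 0 0) \<subseteq> ?E" by (auto intro!: image_eqI[of _ _ "(0, 0)"])
  \<comment> \<open>there is no modulus \<open>b \<le> 0\<close> in \<open>B\<close>, so level \<open>0\<close> imposes no condition\<close>
  have "cylinder B 0 0 = G_set B" using B by (auto simp: cylinder_def)
  then show "(\<Union>i. cylinder B 0 0) = G_set B" by simp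
  show "emeasure P (cylinder B 0 0) \<noteq> \<infinity>" by simp
qed

lemma mult_G_group: "h <#\<^bsub>G_group B\<^esub> A = rotate_G B h ` A"
proof -
  have "x \<otimes>\<^bsub>integer_mod_group b\<^esub> y = (x + y) mod int b" if "b \<in> B" for b x y
    using B_pos[OF that] by (simp add: integer_mod_group_def)
  then have "h \<otimes>\<^bsub>G_group B\<^esub> g = rotate_G B h g" for g
    by (simp add: G_group_def product_group_def rotate_G_def cong: restrict_cong)
  then show ?thesis by (auto simp: l_coset_def)
qed

lemma measurable_rotate_G:
  assumes "h \<in> G_set B" "sets P = sets (clopen_sigma (G_top B))"
  shows "rotate_G B h \<in> measurable P (clopen_sigma (G_top B))"
  unfolding measurable_cong_sets[OF assms(2) refl]
  by (rule measurable_continuous_clopen_sigma[OF continuous_rotate_G[OF assms(1)]])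

text \<open>Invariance under the single rotation by \<open>(1, 1, ...)\<close> implies invariance under all of \<open>G\<close>: rotations commute,
  so the image of an invariant measure under any rotation is again invariant under this one and therefore
  equal to it by uniqueness.\<close>
lemma normalized_haar_iff:
  "normalized_haar (G_group B) (subtopology (residue_top B) (G_set B)) P \<longleftrightarrow>
   prob_space P \<and> sets P = sets (clopen_sigma (G_top B)) \<and> distr P (clopen_sigma (G_top B)) (rotate_one B) = P"
  (is "?H \<longleftrightarrow> ?I")
proof
  have sets_eq: "sets (sigma (topspace (subtopology (residue_top B) (G_set B)))
      {U. openin (subtopology (residue_top B) (G_set B)) U}) = sets (clopen_sigma (G_top B))"
    using sigma_sets_cylinder(2) topspace_G_top by (simp add: G_top_def)
  have carr: "carrier (G_group B) = G_set B" by (simp add: G_group_def)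
  { assume H: ?H
    then have P: "prob_space P" "sets P = sets (clopen_sigma (G_top B))"
      unfolding normalized_haar_def sets_eq by auto
    have sp: "space P = G_set B" using sets_eq_imp_space_eq[OF P(2)] by simp
    have "distr P (clopen_sigma (G_top B)) (rotate_one B) = P"
    proof (rule measure_eqI)
      fix A assume "A \<in> sets (distr P (clopen_sigma (G_top B)) (rotate_one B))"
      then have A: "A \<in> sets P" by (simp add: P)
      then have AG: "A \<subseteq> G_set B" using sets.sets_into_space sp by blast
      let ?A' = "rotate_one B -` A \<inter> G_set B"
      have A': "?A' \<in> sets P" using measurable_sets[OF measurable_rotate_G[OF residues_of_in_G P(2)], of A 1] A P(2) sp by simp
      have "rotate_one B ` ?A' = A"
      proof
        show "A \<subseteq> rotate_one B ` ?A'"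
        proof
          fix g assume "g \<in> A"
          then have g: "g \<in> G_set B" using AG by auto
          let ?g' = "rotate_G B (\<lambda>b\<in>B. (- residues_of B 1 b) mod int b) g"
          have "rotate_one B ?g' = g" by (rule rotate_G_neg_cancel[OF g])
          moreover have "?g' \<in> G_set B" by (intro rotate_G_in_G G_neg residues_of_in_G g)
          ultimately show "g \<in> rotate_one B ` ?A'" using \<open>g \<in> A\<close> by (intro image_eqI[of _ _ ?g']) auto
        qed
      qed auto
      then have "emeasure P A = emeasure P ?A'"
        using H residues_of_in_G[of 1] A' unfolding normalized_haar_def carr mult_G_group by metis
      then show "emeasure (distr P (clopen_sigma (G_top B)) (rotate_one B)) A = emeasure P A"
        using A by (subst emeasure_distr[OF measurable_rotate_G[OF residues_of_in_G P(2)]]) (simp_all add: P sp)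
    qed (simp add: P)
    then show ?I using P by simp }
  { assume ?I
    then have P: "prob_space P" "sets P = sets (clopen_sigma (G_top B))"
      and inv: "distr P (clopen_sigma (G_top B)) (rotate_one B) = P" by auto
    have sp: "space P = G_set B" using sets_eq_imp_space_eq[OF P(2)] by simp
    show ?H
      unfolding normalized_haar_def sets_eq carr mult_G_group
    proof (intro conjI ballI P)
      fix h A assume h: "h \<in> G_set B" and A: "A \<in> sets P"
      define h' where "h' = (\<lambda>b\<in>B. (- h b) mod int b)"
      have h': "h' \<in> G_set B" unfolding h'_def by (rule G_neg[OF h])
      have AG: "A \<subseteq> G_set B" using A sets.sets_into_space sp by blast
      have mh': "rotate_G B h' \<in> measurable P (clopen_sigma (G_top B))" by (rule measurable_rotate_G[OF h' P(2)])
      have modo: "rotate_one B \<in> measurable (clopen_sigma (G_top B)) (clopen_sigma (G_top B))"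
        by (rule measurable_rotate_G[OF residues_of_in_G refl])
      have mh'': "rotate_G B h' \<in> measurable (clopen_sigma (G_top B)) (clopen_sigma (G_top B))"
        by (rule measurable_rotate_G[OF h' refl])
      have modo': "rotate_one B \<in> measurable P (clopen_sigma (G_top B))"
        by (rule measurable_rotate_G[OF residues_of_in_G P(2)])
      have "distr P (clopen_sigma (G_top B)) (rotate_G B h') = P"
      proof (rule odometer_invariant_unique[OF _ _ _ P inv])
        show "prob_space (distr P (clopen_sigma (G_top B)) (rotate_G B h'))"
          by (rule prob_space.prob_space_distr[OF P(1) mh'])
        have "distr (distr P (clopen_sigma (G_top B)) (rotate_G B h')) (clopen_sigma (G_top B)) (rotate_one B) =
            distr P (clopen_sigma (G_top B)) (rotate_one B \<circ> rotate_G B h')"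
          by (rule distr_distr[OF modo mh'])
        also have "rotate_one B \<circ> rotate_G B h' = rotate_G B h' \<circ> rotate_one B" by (simp add: fun_eq_iff rotate_G_commute[of B "residues_of B 1"])
        also have "distr P (clopen_sigma (G_top B)) (rotate_G B h' \<circ> rotate_one B) =
            distr (distr P (clopen_sigma (G_top B)) (rotate_one B)) (clopen_sigma (G_top B)) (rotate_G B h')"
          by (rule distr_distr[OF mh'' modo', symmetric])
        finally show "distr (distr P (clopen_sigma (G_top B)) (rotate_G B h')) (clopen_sigma (G_top B)) (rotate_one B) =
          distr P (clopen_sigma (G_top B)) (rotate_G B h')" by (simp add: inv)
      qed simp
      then have "emeasure P A = emeasure P (rotate_G B h' -` A \<inter> G_set B)"
        using emeasure_distr[OF mh', of A] A P(2) sp by simp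
      also have "rotate_G B h' -` A \<inter> G_set B = rotate_G B h ` A"
      proof (intro equalityI subsetI)
        fix g assume "g \<in> rotate_G B h' -` A \<inter> G_set B"
        then show "g \<in> rotate_G B h ` A"
          using rotate_G_neg_cancel(1)[of g h] by (intro image_eqI[of _ _ "rotate_G B h' g"]) (auto simp: h'_def)
      next
        fix g assume "g \<in> rotate_G B h ` A"
        then obtain a where "a \<in> A" "g = rotate_G B h a" by auto
        then show "g \<in> rotate_G B h' -` A \<inter> G_set B"
          using rotate_G_neg_cancel(2)[of a h] rotate_G_in_G[OF h, of a] AG by (auto simp: h'_def)
      qed
      finally show "emeasure P (rotate_G B h ` A) = emeasure P A" ..
    qed }
qed

text \<open>The Haar measure is a definite description, so uniqueness alone does not determine it. Existence enters
  here through \<open>P\<close>: the invariant measures constructed by averaging have such first marginals.\<close>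
lemma haar_G_eq:
  assumes "prob_space P" "sets P = sets (clopen_sigma (G_top B))" "distr P (clopen_sigma (G_top B)) (rotate_one B) = P"
  shows "haar_G B = P"
  unfolding haar_G_def normalized_haar_iff
  using assms odometer_invariant_unique by (intro the_equality) auto

end

section \<open>The product of the group with the full shift\<close>

abbreviation cantor :: "bseq topology" where "cantor \<equiv> euclidean"

lemma compact_cantor: "compact_space cantor"
proof -
  have "compact_space (product_topology (\<lambda>_::int. euclidean :: bool topology) UNIV)"
    unfolding compact_space_product_topology
    by (intro disjI2 ballI) (simp add: compact_space_def finite_imp_compact)
  then show ?thesis by (simp add: euclidean_product_topology)
qed

lemma cantor_coord_clopen: "{y \<in> topspace cantor. y n} \<in> clopens cantor"
proof -
  have "open ((\<lambda>y::bseq. y n) -` {True})" "closed ((\<lambda>y::bseq. y n) -` {True})"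
    using open_vimage[OF Topological_Spaces.open_discrete, of "\<lambda>y::bseq. y n" "{True}"]
      closed_vimage[OF closed_singleton, of "\<lambda>y::bseq. y n" True] by simp_all
  then show ?thesis by (simp add: clopens_def vimage_def)
qed

lemma continuous_left_shift: "continuous_map cantor cantor left_shift"
  unfolding continuous_map_iff_continuous2 left_shift_def shift_by_def
  by (intro continuous_on_coordinatewise_then_product continuous_on_product_coordinates)

instance bool :: second_countable_topology
proof
  show "\<exists>S::bool set set. countable S \<and> open = generate_topology S"
    by (intro exI[of _ UNIV]) (simp add: fun_eq_iff Topological_Spaces.open_discrete generate_topology.Basis)
qed

lemma borel_measurable_bseqI:
  fixes f :: "'a \<Rightarrow> bseq"
  assumes "\<And>n. {x \<in> space M. f x n} \<in> sets M"
  shows "f \<in> borel_measurable M"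
proof (rule measurable_coordinatewise_then_product)
  fix n
  have "(\<lambda>x. f x n) \<in> measurable M (count_space UNIV)"
    using assms[of n] by (simp add: pred_def)
  then show "(\<lambda>x. f x n) \<in> borel_measurable M"
    by (subst measurable_cong_sets[OF refl sets_borel_eq_count_space])
qed

lemma sets_borel_bseq: "sets (borel :: bseq measure) = sets (clopen_sigma cantor)"
proof
  have "id \<in> borel_measurable (clopen_sigma cantor)"
    by (rule borel_measurable_bseqI) (use clopens_in_sets[OF cantor_coord_clopen] in simp)
  then show "sets borel \<subseteq> sets (clopen_sigma cantor)"
    using measurable_sets[of id "clopen_sigma cantor" borel] by auto
  show "sets (clopen_sigma cantor) \<subseteq> sets borel"
    unfolding sets_clopen_sigma
    by (rule sets.sigma_sets_subset'[where M = borel, simplified]) (auto simp: clopens_def)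
qed

lemma shift_by_add: "shift_by m (shift_by n x) = shift_by (m + n) x"
  by (simp add: shift_by_def add_ac)

definition pair_top :: "nat set \<Rightarrow> ((nat \<Rightarrow> int) \<times> bseq) topology" where
  "pair_top B = prod_topology (G_top B) cantor"

definition pair_map :: "nat set \<Rightarrow> (nat \<Rightarrow> int) \<times> bseq \<Rightarrow> (nat \<Rightarrow> int) \<times> bseq" where
  "pair_map B = (\<lambda>(g, y). (rotate_one B g, left_shift y))"

lemma phi_rotate_one:
  "phi B (rotate_one B g) = left_shift (phi B g)"
proof -
  have "n mod int b = (- rotate_one B g b) mod int b \<longleftrightarrow> (n + 1) mod int b = (- g b) mod int b" if "b \<in> B" for n b
    using that by (simp add: rotate_G_def residues_of_def mod_simps mod_eq_dvd_iff algebra_simps)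
  then show ?thesis by (auto simp: phi_def left_shift_def shift_by_def fun_eq_iff)
qed

lemma phi_iff: "phi B g n \<longleftrightarrow> (\<forall>b\<in>B. n mod int b \<noteq> (- g b) mod int b)"
  by (simp add: phi_def)

lemma eta_iff: "eta C n \<longleftrightarrow> (\<forall>b\<in>C. \<not> int b dvd n)"
  by (auto simp: eta_def free_ints_def dvd_def)

context
  fixes B :: "nat set"
  assumes B: "0 \<notin> B"
begin

lemma topspace_pair_top [simp]: "topspace (pair_top B) = G_set B \<times> UNIV"
  by (simp add: pair_top_def topspace_G_top[OF B])

lemma compact_pair_top: "compact_space (pair_top B)"
  unfolding pair_top_def compact_space_prod_topology using compact_G_top[OF B] compact_cantor by simp

lemma continuous_pair_map: "continuous_map (pair_top B) (pair_top B) (pair_map B)"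
  unfolding pair_top_def pair_map_def continuous_map_prod_top
  using continuous_rotate_G[OF B residues_of_in_G[OF B]] continuous_left_shift by blast

lemma continuous_pair_fst: "continuous_map (pair_top B) (G_top B) fst"
  and continuous_pair_snd: "continuous_map (pair_top B) cantor snd"
  by (simp_all add: pair_top_def continuous_map_fst continuous_map_snd)

lemma pair_fst_clopen:
  assumes "b \<in> B"
  shows "{x \<in> topspace (pair_top B). P (fst x b)} \<in> clopens (pair_top B)"
  by (rule clopens_of_continuous[OF continuous_pair_fst, where P = "\<lambda>g. P (g b)"])
     (use G_coord_clopen[OF B assms] topspace_G_top[OF B] in simp)

lemma pair_snd_clopen: "{x \<in> topspace (pair_top B). snd x n} \<in> clopens (pair_top B)"
  by (rule clopens_of_continuous[OF continuous_pair_snd cantor_coord_clopen])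

lemma pair_map_pow_residues_of:
  "(pair_map B ^^ j) (residues_of B n, y) = (residues_of B (n + int j), shift_by (int j) y)"
proof (induction j)
  case (Suc j)
  then show ?case
    by (simp add: pair_map_def rotate_G_residues_of left_shift_def shift_by_add add_ac)
qed (simp add: shift_by_def)

lemma phi_0_iff: "g \<in> G_set B \<Longrightarrow> phi B g 0 \<longleftrightarrow> (\<forall>b\<in>B. g b \<noteq> 0)"
proof -
  assume "g \<in> G_set B"
  then have "g b mod int b = g b" if "b \<in> B" for b
    using that G_set_subset[OF B] by (force simp: topspace_residue_top[OF B] PiE_iff)
  then show ?thesis
    by (auto simp: phi_def mod_eq_dvd_iff dvd_eq_mod_eq_0)
qed

lemma phi_borel: "phi B \<in> borel_measurable (clopen_sigma (G_top B))"
proof (rule borel_measurable_bseqI)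
  fix n
  have "{g \<in> G_set B. n mod int b \<noteq> (- g b) mod int b} \<in> sets (clopen_sigma (G_top B))" if "b \<in> B" for b
    by (intro clopens_in_sets G_coord_clopen[OF B that])
  then have "{g \<in> space (clopen_sigma (G_top B)). b \<in> B \<longrightarrow> n mod int b \<noteq> (- g b) mod int b} \<in> sets (clopen_sigma (G_top B))" for b
    using topspace_G_top[OF B] sets.top[of "clopen_sigma (G_top B)"] by (cases "b \<in> B") simp_all
  then have "{g \<in> space (clopen_sigma (G_top B)). \<forall>b. b \<in> B \<longrightarrow> n mod int b \<noteq> (- g b) mod int b} \<in> sets (clopen_sigma (G_top B))"
    by (rule sets.sets_Collect_countable_All)
  then show "{g \<in> space (clopen_sigma (G_top B)). phi B g n} \<in> sets (clopen_sigma (G_top B))"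
    by (simp add: phi_iff Ball_def)
qed

context
  fixes \<mu>
  assumes \<mu>: "prob_space \<mu>" "sets \<mu> = sets (clopen_sigma (pair_top B))"
begin

lemma space_pair: "space \<mu> = G_set B \<times> UNIV"
  using sets_eq_imp_space_eq[OF \<mu>(2)] by simp

lemma measurable_pair_fst: "fst \<in> measurable \<mu> (clopen_sigma (G_top B))"
  unfolding measurable_cong_sets[OF \<mu>(2) refl]
  by (rule measurable_continuous_clopen_sigma[OF continuous_pair_fst])

lemma measurable_pair_snd: "snd \<in> borel_measurable \<mu>"
  unfolding measurable_cong_sets[OF \<mu>(2) sets_borel_bseq]
  by (rule measurable_continuous_clopen_sigma[OF continuous_pair_snd])

lemma measurable_pair_map: "pair_map B \<in> measurable \<mu> (clopen_sigma (pair_top B))"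
  unfolding measurable_cong_sets[OF \<mu>(2) refl]
  by (rule measurable_continuous_clopen_sigma[OF continuous_pair_map])

lemma measurable_pair_phi: "(\<lambda>x. phi B (fst x)) \<in> borel_measurable \<mu>"
  by (rule measurable_compose[OF measurable_pair_fst phi_borel])

text \<open>The first marginal of an invariant measure on pairs is invariant under the rotation, hence the Haar
  measure.\<close>
lemma mirsky_eq_marginal:
  assumes inv: "distr \<mu> (clopen_sigma (pair_top B)) (pair_map B) = \<mu>"
  shows "mirsky B = distr \<mu> borel (\<lambda>x. phi B (fst x))"
proof -
  let ?S = "clopen_sigma (G_top B)"
  have rotate_one: "rotate_one B \<in> measurable ?S ?S" by (rule measurable_rotate_G[OF B residues_of_in_G[OF B] refl])
  have fst': "fst \<in> measurable (clopen_sigma (pair_top B)) ?S"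
    by (rule measurable_continuous_clopen_sigma[OF continuous_pair_fst])
  have "haar_G B = distr \<mu> ?S fst"
  proof (rule haar_G_eq[OF B])
    show "prob_space (distr \<mu> ?S fst)" by (rule prob_space.prob_space_distr[OF \<mu>(1) measurable_pair_fst])
    have "distr (distr \<mu> ?S fst) ?S (rotate_one B) = distr \<mu> ?S (rotate_one B \<circ> fst)"
      by (rule distr_distr[OF rotate_one measurable_pair_fst])
    also have "rotate_one B \<circ> fst = fst \<circ> pair_map B" by (auto simp: pair_map_def)
    also have "distr \<mu> ?S (fst \<circ> pair_map B) = distr (distr \<mu> (clopen_sigma (pair_top B)) (pair_map B)) ?S fst"
      by (rule distr_distr[OF fst' measurable_pair_map, symmetric])
    finally show "distr (distr \<mu> ?S fst) ?S (rotate_one B) = distr \<mu> ?S fst" by (simp add: inv)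
  qed simp
  then show ?thesis
    unfolding mirsky_def by (simp add: distr_distr[OF phi_borel measurable_pair_fst] o_def)
qed

text \<open>The set of pairs with \<open>y \<le> \<phi>(g)\<close> is the intersection of countably many clopen sets, one for each modulus
  and each position. Whether they have full measure can be read off from approximating measures.\<close>
lemma AE_le_phi:
  assumes "\<And>b n. b \<in> B \<Longrightarrow>
    measure \<mu> {x \<in> topspace (pair_top B). \<not> (n mod int b = (- fst x b) mod int b \<and> snd x n)} = 1"
  shows "AE x in \<mu>. snd x \<le> phi B (fst x)"
proof -
  interpret prob_space \<mu> by fact
  have "AE x in \<mu>. snd x n \<longrightarrow> n mod int b \<noteq> (- fst x b) mod int b" if "b \<in> B" for b n
  proof -
    let ?A = "{x \<in> topspace (pair_top B). \<not> (n mod int b = (- fst x b) mod int b \<and> snd x n)}"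
    have "?A \<in> sets \<mu>" unfolding \<mu>(2)
      by (intro clopens_in_sets clopens_Compl clopens_conj pair_snd_clopen pair_fst_clopen that)
    then have "AE x in \<mu>. x \<in> ?A" using assms[OF that, of n] by (simp add: prob_eq_1)
    then show ?thesis by (rule AE_mp) (auto intro!: AE_I2)
  qed
  then have "AE x in \<mu>. \<forall>b\<in>B. \<forall>n. snd x n \<longrightarrow> n mod int b \<noteq> (- fst x b) mod int b"
    by (intro AE_ball_countable[THEN iffD2] ballI) (auto simp: AE_all_countable)
  then show ?thesis by (rule AE_mp) (auto intro!: AE_I2 simp: phi_iff le_fun_def)
qed

end

end

section \<open>The Mirsky measure is carried by the orbit closure\<close>

text \<open>Only finitely many patterns fit into a finite window.\<close>
lemma finite_window_clopen:
  "{y \<in> topspace cantor. \<exists>m. \<forall>i\<in>{- int N..int N}. y i = x (i + m)} \<in> clopens cantor"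
proof -
  let ?I = "{- int N..int N}"
  let ?W = "(\<lambda>m. {i \<in> ?I. x (i + m)}) ` (UNIV :: int set)"
  have "finite ?W" by (rule finite_subset[of _ "Pow ?I"]) auto
  then have "{y \<in> topspace cantor. \<exists>w\<in>?W. \<forall>i\<in>?I. y i = (i \<in> w)} \<in> clopens cantor"
  proof (rule clopens_bex)
    fix w :: "int set"
    show "{y \<in> topspace cantor. \<forall>i\<in>?I. y i = (i \<in> w)} \<in> clopens cantor"
    proof (rule clopens_ball)
      show "{y \<in> topspace cantor. y i = (i \<in> w)} \<in> clopens cantor" for i
        using cantor_coord_clopen[of i] clopens_Compl[OF cantor_coord_clopen[of i]] by (cases "i \<in> w") simp_all
    qed simp
  qed
  moreover have "(\<exists>w\<in>?W. \<forall>i\<in>?I. y i = (i \<in> w)) \<longleftrightarrow> (\<exists>m. \<forall>i\<in>?I. y i = x (i + m))" for y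
    by auto
  ultimately show ?thesis by simp
qed

lemma in_orbit_closureI:
  assumes "\<And>N. \<exists>m. \<forall>i\<in>{- int N..int N}. y i = x (i + m)"
  shows "y \<in> closure (range (\<lambda>m. shift_by m x))"
proof -
  obtain m where m: "\<And>N i. i \<in> {- int N..int N} \<Longrightarrow> y i = x (i + m N)"
    using assms by metis
  have "(\<lambda>N. shift_by (m N) x) \<longlonglongrightarrow> y"
  proof -
    have "(\<lambda>N. shift_by (m N) x i) \<longlonglongrightarrow> y i" for i
    proof (rule tendsto_eventually)
      show "eventually (\<lambda>N. shift_by (m N) x i = y i) sequentially"
        unfolding eventually_sequentially
      proof (intro exI[of _ "nat \<bar>i\<bar>"] allI impI)
        fix N assume "nat \<bar>i\<bar> \<le> N"
        then have "i \<in> {- int N..int N}" by auto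
        then show "shift_by (m N) x i = y i" by (simp add: shift_by_def m)
      qed
    qed
    then have "limitin (product_topology (\<lambda>_::int. euclidean :: bool topology) UNIV)
        (\<lambda>N. shift_by (m N) x) y sequentially"
      by (simp add: limitin_componentwise)
    then show ?thesis by (simp add: euclidean_product_topology)
  qed
  then show ?thesis by (auto simp: closure_sequential intro!: exI[of _ "\<lambda>N. shift_by (m N) x"])
qed

text \<open>Let \<open>\<mu>\<close> be a limit of the distributions of \<open>(n, S\<^sup>n \<eta>)\<close> for zeta-distributed \<open>n\<close>. Facts \<open>le\<close> and \<open>X\<close> hold
  because they are countable conjunctions of clopen conditions satisfied by every \<open>(n, S\<^sup>n \<eta>)\<close>. Fact \<open>ge\<close> is the arithmetic
  core; with \<open>le\<close> it forces \<open>x 0 = \<phi>(g) 0\<close> almost surely, and invariance moves this equality to all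
  positions. Hence \<open>\<phi>(g) = x\<close> lies in \<open>X_eta\<close> for almost every \<open>g\<close>.\<close>
lemma mirsky_X_eta:
  assumes B: "0 \<notin> B"
  shows "emeasure (mirsky B) (X_eta B) = 1"
proof -
  define s where "s k = 1 + 1 / real (Suc k)" for k
  have s1: "s k > 1" for k by (simp add: s_def)
  \<comment> \<open>the starting point is deterministic, so it is carried by a one-point probability space\<close>
  define N where "N = return (count_space UNIV) ()"
  interpret N: prob_space N unfolding N_def by (rule prob_space_return) simp
  define f where "f = (\<lambda>_::unit. (residues_of B 1, shift_by 1 (eta B)))"
  define orb where "orb j = (residues_of B (int (Suc j)), shift_by (int (Suc j)) (eta B))" for j
  have f: "f \<in> measurable N (clopen_sigma (pair_top B))"
    by (rule measurable_clopen_sigmaI) (auto simp: f_def N_def topspace_pair_top[OF B] residues_of_in_G[OF B])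
  have "(\<lambda>k. pmf (zeta_pmf (s k)) 0) \<longlonglongrightarrow> 0" unfolding s_def by (rule pmf_zeta_0_tendsto)
  then obtain F \<mu> where F: "F \<noteq> bot" "F \<le> sequentially" and \<mu>: "prob_space \<mu>" "sets \<mu> = sets (clopen_sigma (pair_top B))"
    and inv: "distr \<mu> (clopen_sigma (pair_top B)) (pair_map B) = \<mu>"
    and lim0: "\<And>A. A \<in> clopens (pair_top B) \<Longrightarrow> ((\<lambda>k. measure_pmf.expectation (zeta_pmf (s k))
       (\<lambda>j. measure N {y \<in> space N. (pair_map B ^^ j) (f y) \<in> A})) \<longlongrightarrow> measure \<mu> A) F"
    using weighted_Krylov_Bogoliubov[where X = "pair_top B" and T = "pair_map B" and N = "\<lambda>_. N" and f = "\<lambda>_. f"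
        and p = "\<lambda>k. zeta_pmf (s k)", OF compact_pair_top[OF B] continuous_pair_map[OF B] N.prob_space_axioms f
        antimono_pmf_zeta[OF s1]] by blast
  interpret prob_space \<mu> by fact
  have lim: "((\<lambda>k. measure (measure_pmf (zeta_pmf (s k))) {j. orb j \<in> A}) \<longlongrightarrow> measure \<mu> A) F"
    if "A \<in> clopens (pair_top B)" for A
  proof -
    have "(pair_map B ^^ j) (f y) = orb j" for j y
      by (simp add: f_def orb_def pair_map_pow_residues_of[OF B] shift_by_add add_ac)
    then have "measure N {y \<in> space N. (pair_map B ^^ j) (f y) \<in> A} = indicator {j. orb j \<in> A} j" for j
      using N.prob_space by (simp add: N_def indicator_def)
    then show ?thesis using lim0[OF that] by simp
  qed
  have full: "measure \<mu> {x \<in> topspace (pair_top B). P x} = 1"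
    if "{x \<in> topspace (pair_top B). P x} \<in> clopens (pair_top B)" "\<And>j. P (orb j)" for P
  proof -
    have "{j. orb j \<in> {x \<in> topspace (pair_top B). P x}} = UNIV"
      using that(2) by (auto simp: orb_def topspace_pair_top[OF B] residues_of_in_G[OF B])
    then have "((\<lambda>k. 1) \<longlongrightarrow> measure \<mu> {x \<in> topspace (pair_top B). P x}) F"
      using lim[OF that(1)] by simp
    then show ?thesis using tendsto_unique[OF F(1) _ tendsto_const] by blast
  qed
  have sp: "space \<mu> = G_set B \<times> UNIV" by (rule space_pair[OF B \<mu>])
  have top: "topspace (pair_top B) = space \<mu>" by (simp add: sp topspace_pair_top[OF B])

  have le: "AE x in \<mu>. snd x \<le> phi B (fst x)"
  proof (rule AE_le_phi[OF B \<mu>])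
    fix b n assume b: "b \<in> B"
    show "measure \<mu> {x \<in> topspace (pair_top B). \<not> (n mod int b = (- fst x b) mod int b \<and> snd x n)} = 1"
    proof (rule full)
      show "{x \<in> topspace (pair_top B). \<not> (n mod int b = (- fst x b) mod int b \<and> snd x n)} \<in> clopens (pair_top B)"
        by (intro clopens_Compl clopens_conj pair_snd_clopen[OF B] pair_fst_clopen[OF B b])
      show "\<not> (n mod int b = (- fst (orb j) b) mod int b \<and> snd (orb j) n)" for j
        using b by (auto simp: orb_def residues_of_def mod_simps mod_eq_dvd_iff shift_by_def eta_iff algebra_simps)
    qed
  qed

  have X: "AE x in \<mu>. snd x \<in> X_eta B"
  proof -
    have "AE x in \<mu>. \<exists>m. \<forall>i\<in>{- int N..int N}. snd x i = eta B (i + m)" for N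
    proof -
      let ?A = "{x \<in> topspace (pair_top B). \<exists>m. \<forall>i\<in>{- int N..int N}. snd x i = eta B (i + m)}"
      have A: "?A \<in> clopens (pair_top B)"
        by (rule clopens_of_continuous[OF continuous_pair_snd[OF B] finite_window_clopen])
      then have "measure \<mu> ?A = 1"
        by (rule full) (auto simp: orb_def shift_by_def)
      moreover have "?A \<in> sets \<mu>" using A unfolding \<mu>(2) by (rule clopens_in_sets)
      ultimately have "AE x in \<mu>. x \<in> ?A" by (simp add: prob_eq_1)
      then show ?thesis by (rule AE_mp) (auto intro!: AE_I2)
    qed
    then have "AE x in \<mu>. \<forall>N. \<exists>m. \<forall>i\<in>{- int N..int N}. snd x i = eta B (i + m)"
      by (simp add: AE_all_countable)
    then show ?thesis by (rule AE_mp) (auto intro!: AE_I2 in_orbit_closureI simp: X_eta_def)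
  qed

  have snd_ev: "{x \<in> space \<mu>. snd x n} \<in> sets \<mu>" for n
    using clopens_in_sets[OF pair_snd_clopen[OF B, of n]] by (simp add: \<mu>(2) top)
  have phi_ev: "{x \<in> space \<mu>. phi B (fst x) n} \<in> sets \<mu>" for n
  proof -
    have "(\<lambda>x. phi B (fst x) n) \<in> borel_measurable \<mu>"
      by (rule measurable_product_then_coordinatewise[OF measurable_pair_phi[OF B \<mu>]])
    then have "(\<lambda>x. phi B (fst x) n) -` {True} \<inter> space \<mu> \<in> sets \<mu>" by (rule measurable_sets) simp
    then show ?thesis by (simp add: vimage_def Int_def conj_commute)
  qed

  have ge: "measure \<mu> {x \<in> space \<mu>. phi B (fst x) 0} \<le> measure \<mu> {x \<in> space \<mu>. snd x 0}"
  proof -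
    \<comment> \<open>\<open>M K\<close>: multiples of the moduli up to \<open>K\<close>; \<open>D\<close>: Haar measure of the residue systems with some coordinate \<open>0\<close>\<close>
    define M where "M K = {n. \<exists>b\<in>B \<inter> {..K}. b dvd n}" for K :: nat
    define D where "D = measure \<mu> {x \<in> space \<mu>. \<not> phi B (fst x) 0}"
    let ?p = "\<lambda>k. measure (measure_pmf (zeta_pmf (s k)))"
    \<comment> \<open>by monotonicity in the exponent, the weight at a fixed \<open>s k\<close> is at most its limit, the Haar measure of a clopen set\<close>
    have M_le: "?p k {j. Suc j \<in> M K} \<le> D" for k K
    proof -
      let ?A = "{x \<in> topspace (pair_top B). \<exists>b\<in>B \<inter> {..K}. fst x b = 0}"
      have A: "?A \<in> clopens (pair_top B)"
        by (rule clopens_bex) (auto intro!: pair_fst_clopen[OF B])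
      have "int n mod int b = 0 \<longleftrightarrow> b dvd n" for n b
        by (metis dvd_eq_mod_eq_0 of_nat_0_eq_iff of_nat_mod)
      then have "{j. orb j \<in> ?A} = {j. Suc j \<in> M K}"
        using residues_of_in_G[OF B]
        by (auto simp: M_def orb_def topspace_pair_top[OF B] residues_of_def simp del: of_nat_Suc)
      then have "((\<lambda>k. ?p k {j. Suc j \<in> M K}) \<longlongrightarrow> measure \<mu> ?A) F" using lim[OF A] by simp
      moreover have "eventually (\<lambda>k'. ?p k {j. Suc j \<in> M K} \<le> ?p k' {j. Suc j \<in> M K}) F"
      proof (rule filter_leD[OF F(2)])
        show "eventually (\<lambda>k'. ?p k {j. Suc j \<in> M K} \<le> ?p k' {j. Suc j \<in> M K}) sequentially"
          unfolding eventually_sequentially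
        proof (intro exI[of _ k] allI impI)
          fix k' assume "k \<le> k'"
          then have "s k' \<le> s k" by (simp add: s_def frac_le)
          then show "?p k {j. Suc j \<in> M K} \<le> ?p k' {j. Suc j \<in> M K}"
            by (rule zeta_pmf_multiples_antimono[OF s1]) (auto simp: M_def intro: dvd_trans)
        qed
      qed
      ultimately have "?p k {j. Suc j \<in> M K} \<le> measure \<mu> ?A"
        by (intro tendsto_lowerbound[OF _ _ F(1)])
      also have "\<dots> \<le> D"
        unfolding D_def
      proof (rule finite_measure_mono)
        show "?A \<subseteq> {x \<in> space \<mu>. \<not> phi B (fst x) 0}"
          by (auto simp: sp topspace_pair_top[OF B] phi_0_iff[OF B])
        show "{x \<in> space \<mu>. \<not> phi B (fst x) 0} \<in> sets \<mu>" using phi_ev[of 0] by (rule sets.sets_Collect_neg)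
      qed
      finally show ?thesis .
    qed
    \<comment> \<open>countable additivity at the fixed exponent \<open>s k\<close>\<close>
    have eta_ge: "1 - D \<le> ?p k {j. eta B (int (Suc j))}" for k
    proof -
      have "(\<lambda>K. ?p k {j. Suc j \<in> M K}) \<longlonglongrightarrow> ?p k (\<Union>K. {j. Suc j \<in> M K})"
        by (rule measure_pmf.finite_Lim_measure_incseq) (force simp: M_def incseq_def)+
      then have "?p k (\<Union>K. {j. Suc j \<in> M K}) \<le> D" by (rule LIMSEQ_le_const2) (use M_le in auto)
      moreover have "{j. eta B (int (Suc j))} = UNIV - (\<Union>K. {j. Suc j \<in> M K})"
        by (auto simp: M_def eta_iff int_dvd_int_iff simp del: of_nat_Suc)
      ultimately show ?thesis
        using measure_pmf.prob_compl[of "\<Union>K. {j. Suc j \<in> M K}" "zeta_pmf (s k)"] by simp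
    qed
    have "{j. orb j \<in> {x \<in> topspace (pair_top B). snd x 0}} = {j. eta B (int (Suc j))}"
      by (auto simp: orb_def topspace_pair_top[OF B] residues_of_in_G[OF B] shift_by_def)
    then have "((\<lambda>k. ?p k {j. eta B (int (Suc j))}) \<longlongrightarrow> measure \<mu> {x \<in> space \<mu>. snd x 0}) F"
      using lim[OF pair_snd_clopen[OF B, of 0]] by (simp add: top)
    then have "1 - D \<le> measure \<mu> {x \<in> space \<mu>. snd x 0}"
      by (rule tendsto_lowerbound[OF _ _ F(1)]) (use eta_ge in auto)
    moreover have "measure \<mu> {x \<in> space \<mu>. phi B (fst x) 0} = 1 - D"
      using prob_neg[of "\<lambda>x. phi B (fst x) 0"] phi_ev[of 0] by (simp add: D_def)
    ultimately show ?thesis by simp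
  qed

  define E where "E n = {x \<in> space \<mu>. snd x n \<noteq> phi B (fst x) n}" for n
  have E_ev: "E n \<in> sets \<mu>" for n
  proof -
    have "E n = ({x \<in> space \<mu>. snd x n} - {x \<in> space \<mu>. phi B (fst x) n}) \<union>
        ({x \<in> space \<mu>. phi B (fst x) n} - {x \<in> space \<mu>. snd x n})" by (auto simp: E_def)
    then show ?thesis using snd_ev phi_ev by simp
  qed
  have E0: "measure \<mu> (E 0) = 0"
  proof -
    let ?A = "{x \<in> space \<mu>. snd x 0}" and ?C = "{x \<in> space \<mu>. phi B (fst x) 0}"
    have "measure \<mu> (?A - ?C) = 0"
    proof -
      have "AE x in \<mu>. x \<notin> ?A - ?C" using le by (rule AE_mp) (auto intro!: AE_I2 simp: le_fun_def)
      then show ?thesis using snd_ev[of 0] phi_ev[of 0] by (subst prob_eq_0) auto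
    qed
    moreover have "measure \<mu> ?A = measure \<mu> (?A - ?C) + measure \<mu> (?A \<inter> ?C)"
      using snd_ev[of 0] phi_ev[of 0] by (subst finite_measure_Union[symmetric]) (auto intro!: arg_cong[where f = "measure \<mu>"])
    moreover have "measure \<mu> ?C = measure \<mu> (?C - ?A) + measure \<mu> (?A \<inter> ?C)"
      using snd_ev[of 0] phi_ev[of 0] by (subst finite_measure_Union[symmetric]) (auto intro!: arg_cong[where f = "measure \<mu>"])
    moreover have "E 0 = (?A - ?C) \<union> (?C - ?A)" by (auto simp: E_def)
    moreover have "measure \<mu> ((?A - ?C) \<union> (?C - ?A)) = measure \<mu> (?A - ?C) + measure \<mu> (?C - ?A)"
      using snd_ev[of 0] phi_ev[of 0] by (intro finite_measure_Union) auto
    ultimately show ?thesis using ge measure_nonneg[of \<mu> "?C - ?A"] by simp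
  qed
  have E_Suc: "measure \<mu> (E (n + 1)) = measure \<mu> (E n)" for n
  proof -
    have "measure \<mu> (E n) = measure (distr \<mu> (clopen_sigma (pair_top B)) (pair_map B)) (E n)" by (simp add: inv)
    also have "\<dots> = measure \<mu> (pair_map B -` E n \<inter> space \<mu>)"
      using E_ev[of n] by (intro measure_distr measurable_pair_map[OF B \<mu>]) (simp add: \<mu>(2))
    also have "pair_map B -` E n \<inter> space \<mu> = E (n + 1)"
      using rotate_G_in_G[OF B residues_of_in_G[OF B]]
      by (auto simp: E_def pair_map_def sp phi_rotate_one left_shift_def shift_by_def)
    finally show ?thesis ..
  qed
  have "measure \<mu> (E n) = 0" for n
  proof (induction n rule: int_induct[where k = 0])
    case (step1 i) then show ?case using E_Suc[of i] by simp
  next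
    case (step2 i) then show ?case using E_Suc[of "i - 1"] by simp
  qed (rule E0)
  then have "AE x in \<mu>. \<forall>n. x \<notin> E n"
    using E_ev by (simp add: AE_all_countable prob_eq_0)
  then have "AE x in \<mu>. snd x = phi B (fst x)"
    by (rule AE_mp) (auto intro!: AE_I2 simp: E_def)
  with X have phiX: "AE x in \<mu>. phi B (fst x) \<in> X_eta B"
    by eventually_elim simp
  have mirsky: "mirsky B = distr \<mu> borel (\<lambda>x. phi B (fst x))"
    by (rule mirsky_eq_marginal[OF B \<mu> inv])
  note phi_m = measurable_pair_phi[OF B \<mu>]
  have P: "prob_space (mirsky B)" unfolding mirsky by (rule prob_space_distr[OF phi_m])
  have "closed (X_eta B)" by (simp add: X_eta_def)
  then have "AE y in mirsky B. y \<in> X_eta B"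
    unfolding mirsky using phiX by (subst AE_distr_iff[OF phi_m]) (auto simp: Collect_mem_eq)
  then show "emeasure (mirsky B) (X_eta B) = 1"
    using \<open>closed (X_eta B)\<close> by (intro prob_space.emeasure_eq_1_AE[OF P]) (auto simp: mirsky)
qed

section \<open>Lifting measures on the hereditary closure\<close>

lemma closed_le_bseq: "closed {y::bseq. y \<le> z}"
proof -
  have eq: "{y::bseq. y \<le> z} = (\<Inter>n\<in>{n. \<not> z n}. - {y. y n})" by (auto simp: le_fun_def)
  have "open {y::bseq. y n}" for n using cantor_coord_clopen[of n] by (simp add: clopens_def)
  then show ?thesis unfolding eq by (intro closed_INT ballI) (simp add: closed_Compl)
qed

text \<open>The sequences below some translate of the periodic sequence \<open>\<eta>(B \<inter> {..k})\<close> form a hereditary subshift. It is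
  closed because periodicity leaves finitely many translates, and it contains \<open>X_eta\<close> because
  \<open>\<eta>(B) \<le> \<eta>(B \<inter> {..k})\<close>.\<close>
lemma hereditary_closure_le_shift:
  assumes B: "0 \<notin> B" and y: "y \<in> hereditary_closure_X_eta B"
  shows "\<exists>n. y \<le> shift_by (int n) (eta (B \<inter> {..k}))"
proof -
  define e where "e = eta (B \<inter> {..k})"
  define L where "L = int (\<Prod>b\<in>B \<inter> {..k}. b)"
  have "(\<Prod>b\<in>B \<inter> {..k}. b) > 0" using B by (intro prod_pos) (auto intro!: Nat.gr0I)
  then have L: "L > 0" unfolding L_def by (simp only: of_nat_0_less_iff)
  have dvd_L: "int b dvd L" if "b \<in> B \<inter> {..k}" for b
    unfolding L_def int_dvd_int_iff using that by (intro dvd_prodI) auto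
  \<comment> \<open>the product \<open>L\<close> of the moduli involved is a period\<close>
  have per: "shift_by m e = shift_by (m mod L) e" for m
  proof -
    have "int b dvd n + m \<longleftrightarrow> int b dvd n + m mod L" if "b \<in> B \<inter> {..k}" for b n
    proof -
      have "int b dvd (n + m) - (n + m mod L)"
        using dvd_trans[OF dvd_L[OF that], of "m - m mod L"] by (simp add: minus_mod_eq_mult_div)
      then show ?thesis by (metis dvd_diff_right_iff dvd_add_right_iff diff_add_cancel)
    qed
    then show ?thesis by (simp add: e_def shift_by_def eta_iff fun_eq_iff)
  qed
  define Z where "Z = {y. \<exists>m. y \<le> shift_by m e}"
  have Z_fin: "Z = (\<Union>m\<in>{0..<L}. {y. y \<le> shift_by m e})"
  proof (intro equalityI subsetI)
    fix y assume "y \<in> Z"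
    then obtain m where "y \<le> shift_by (m mod L) e" using per unfolding Z_def by auto
    moreover have "m mod L \<in> {0..<L}" using L by simp
    ultimately show "y \<in> (\<Union>m\<in>{0..<L}. {y. y \<le> shift_by m e})" by blast
  qed (auto simp: Z_def)
  have "closed Z" unfolding Z_fin by (intro closed_UN ballI closed_le_bseq) simp
  have mono: "shift_by i y \<le> shift_by (i + m) e" if "y \<le> shift_by m e" for y i m
    using that by (auto simp: shift_by_def le_fun_def add_ac)
  have "left_shift ` Z = Z"
  proof (intro equalityI subsetI)
    fix y assume "y \<in> left_shift ` Z"
    then show "y \<in> Z" using mono unfolding Z_def left_shift_def by blast
  next
    fix y assume "y \<in> Z"
    then have "shift_by (- 1) y \<in> Z" using mono unfolding Z_def by blast
    moreover have "y = left_shift (shift_by (- 1) y)" by (simp add: left_shift_def shift_by_def)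
    ultimately show "y \<in> left_shift ` Z" by blast
  qed
  moreover have "hereditary Z" unfolding hereditary_def Z_def by (auto intro: order_trans)
  moreover have "X_eta B \<subseteq> Z"
    unfolding X_eta_def
  proof (rule closure_minimal[OF _ \<open>closed Z\<close>], clarify)
    fix m
    have "shift_by m (eta B) \<le> shift_by m e" by (auto simp: e_def shift_by_def eta_iff le_fun_def)
    then show "shift_by m (eta B) \<in> Z" by (auto simp: Z_def)
  qed
  ultimately have "y \<in> Z"
    using y \<open>closed Z\<close> by (auto simp: hereditary_closure_X_eta_def subshift_def)
  then obtain m where "m \<in> {0..<L}" "y \<le> shift_by m e" unfolding Z_fin by blast
  then show ?thesis unfolding e_def[symmetric] by (intro exI[of _ "nat m"]) simp
qed

lemma measure_shift_by:
  assumes \<nu>: "prob_space \<nu>" "sets \<nu> = sets borel" and inv: "distr \<nu> borel left_shift = \<nu>"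
    and D: "D \<in> sets borel"
  shows "measure \<nu> {y. shift_by (int j) y \<in> D} = measure \<nu> D"
proof (induction j)
  case (Suc j)
  have sp: "space \<nu> = UNIV" using sets_eq_imp_space_eq[OF \<nu>(2)] by simp
  have S: "shift_by (int j) \<in> borel_measurable borel"
    by (intro borel_measurable_continuous_onI continuous_on_coordinatewise_then_product)
       (simp add: shift_by_def)
  have E: "{y. shift_by (int j) y \<in> D} \<in> sets borel"
    using measurable_sets[OF S D] by (simp add: vimage_def)
  have "left_shift \<in> borel_measurable \<nu>"
    unfolding measurable_cong_sets[OF \<nu>(2) refl]
    using continuous_left_shift by (intro borel_measurable_continuous_onI) simp
  then have "measure (distr \<nu> borel left_shift) {y. shift_by (int j) y \<in> D} = measure \<nu> {y. shift_by (int (Suc j)) y \<in> D}"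
    using E by (subst measure_distr) (auto simp: sp vimage_def left_shift_def shift_by_add add_ac)
  then show ?case using Suc inv by simp
qed (simp add: shift_by_def)

text \<open>The least translate \<open>r k y\<close> depends measurably on \<open>y\<close>, and \<open>(r k y, y)\<close> satisfies the constraints from moduli
  \<open>b \<le> k\<close>, as do all points of its orbit. Averaging along the orbit does not change the second marginal
  because \<open>\<nu>\<close> is shift invariant. Both properties concern clopen sets whose averages are eventually constant
  in \<open>k\<close>, so they pass to the limit.\<close>
lemma lift_invariant_measure:
  fixes B :: "nat set" and \<nu> :: "bseq measure"
  assumes B: "0 \<notin> B" and \<nu>: "\<nu> \<in> inv_prob left_shift (hereditary_closure_X_eta B)"
  obtains \<mu> where "prob_space \<mu>" "sets \<mu> = sets (clopen_sigma (pair_top B))"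
    "distr \<mu> (clopen_sigma (pair_top B)) (pair_map B) = \<mu>"
    "distr \<mu> borel snd = \<nu>" "AE x in \<mu>. snd x \<le> phi B (fst x)"
proof -
  have \<nu>p: "prob_space \<nu>" and \<nu>s: "sets \<nu> = sets borel" and \<nu>i: "distr \<nu> borel left_shift = \<nu>"
    and H: "hereditary_closure_X_eta B \<in> sets borel" "emeasure \<nu> (hereditary_closure_X_eta B) = 1"
    using \<nu> by (auto simp: inv_prob_def)
  interpret \<nu>: prob_space \<nu> by fact
  have \<nu>sp: "space \<nu> = UNIV" using sets_eq_imp_space_eq[OF \<nu>s] by simp
  have AE_H: "AE y in \<nu>. y \<in> hereditary_closure_X_eta B"
    using H \<nu>s by (subst \<nu>.prob_eq_1[symmetric]) (auto simp: \<nu>.emeasure_eq_measure)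
  define r where "r k y = (LEAST n. y \<le> shift_by (int n) (eta (B \<inter> {..k})))" for k y
  define f where "f k y = (residues_of B (int (r k y)), y)" for k y
  have r: "r k \<in> measurable \<nu> (count_space UNIV)" for k
    unfolding r_def
  proof (rule measurable_Least)
    fix i
    have "{y. y \<le> shift_by (int i) (eta (B \<inter> {..k}))} \<in> sets \<nu>"
      unfolding \<nu>s using closed_le_bseq by simp
    then show "(\<lambda>y. y \<le> shift_by (int i) (eta (B \<inter> {..k}))) \<in> measurable \<nu> (count_space UNIV)"
      by (simp add: pred_def \<nu>sp)
  qed
  have f: "f k \<in> measurable \<nu> (clopen_sigma (pair_top B))" for k
  proof (rule measurable_clopen_sigmaI)
    show "f k \<in> space \<nu> \<rightarrow> topspace (pair_top B)"
      by (simp add: f_def topspace_pair_top[OF B] residues_of_in_G[OF B])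
    fix A assume A: "A \<in> clopens (pair_top B)"
    have "(\<lambda>y. (residues_of B (int n), y)) -` A \<inter> topspace cantor \<in> clopens cantor" for n
    proof (rule clopens_vimage[OF _ A])
      show "continuous_map cantor (pair_top B) (\<lambda>y. (residues_of B (int n), y))"
        unfolding pair_top_def
        by (intro continuous_map_pairedI) (auto simp: topspace_G_top[OF B] residues_of_in_G[OF B])
    qed
    then have "(\<lambda>y. (residues_of B (int n), y)) -` A \<in> sets \<nu>" for n
      using clopens_in_sets unfolding \<nu>s sets_borel_bseq by fastforce
    moreover have "r k -` {n} \<in> sets \<nu>" for n
      using measurable_sets[OF r, of "{n}" k] by (simp add: \<nu>sp)
    ultimately have "(\<Union>n. r k -` {n} \<inter> (\<lambda>y. (residues_of B (int n), y)) -` A) \<in> sets \<nu>" by blast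
    also have "(\<Union>n. r k -` {n} \<inter> (\<lambda>y. (residues_of B (int n), y)) -` A) = f k -` A \<inter> space \<nu>"
      by (auto simp: f_def \<nu>sp)
    finally show "f k -` A \<inter> space \<nu> \<in> sets \<nu>" .
  qed
  define p where "p k = zeta_pmf (1 + 1 / real (Suc k))" for k
  have p: "antimono (pmf (p k))" for k unfolding p_def by (rule antimono_pmf_zeta) simp
  have p0: "(\<lambda>k. pmf (p k) 0) \<longlonglongrightarrow> 0" unfolding p_def by (rule pmf_zeta_0_tendsto)
  obtain F \<mu> where F: "F \<noteq> bot" "F \<le> sequentially" and \<mu>: "prob_space \<mu>" "sets \<mu> = sets (clopen_sigma (pair_top B))"
    and inv: "distr \<mu> (clopen_sigma (pair_top B)) (pair_map B) = \<mu>"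
    and lim: "\<And>A. A \<in> clopens (pair_top B) \<Longrightarrow> ((\<lambda>k. measure_pmf.expectation (p k)
       (\<lambda>j. measure \<nu> {y \<in> space \<nu>. (pair_map B ^^ j) (f k y) \<in> A})) \<longlongrightarrow> measure \<mu> A) F"
    using weighted_Krylov_Bogoliubov[where X = "pair_top B" and T = "pair_map B" and N = "\<lambda>_. \<nu>" and f = f
        and p = p, OF compact_pair_top[OF B] continuous_pair_map[OF B] \<nu>p f p p0] by blast
  have orb: "(pair_map B ^^ j) (f k y) = (residues_of B (int (r k y) + int j), shift_by (int j) y)" for j k y
    by (simp add: f_def pair_map_pow_residues_of[OF B])
  have lim_unique: "measure \<mu> A = c" if A: "A \<in> clopens (pair_top B)"
    and c: "eventually (\<lambda>k. \<forall>j. measure \<nu> {y. (residues_of B (int (r k y) + int j), shift_by (int j) y) \<in> A} = c) sequentially"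
    for A c
  proof -
    have "eventually (\<lambda>k. measure_pmf.expectation (p k)
       (\<lambda>j. measure \<nu> {y \<in> space \<nu>. (pair_map B ^^ j) (f k y) \<in> A}) = c) F"
      using filter_leD[OF F(2) c] by eventually_elim (simp add: orb \<nu>sp)
    then have "((\<lambda>k. c) \<longlongrightarrow> measure \<mu> A) F" using lim[OF A] by (rule Lim_transform_eventually[rotated])
    then show ?thesis using tendsto_unique[OF F(1) _ tendsto_const] by blast
  qed
  have in_top: "(residues_of B n, y) \<in> topspace (pair_top B)" for n y
    by (simp add: topspace_pair_top[OF B] residues_of_in_G[OF B])
  have top: "topspace (pair_top B) = space \<mu>"
    using space_pair[OF B \<mu>] topspace_pair_top[OF B] by simp
  note snd_m = measurable_pair_snd[OF B \<mu>]
  have marg: "distr \<mu> borel snd = \<nu>"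
  proof (rule measure_eqI_clopens[where X = cantor])
    show "prob_space (distr \<mu> borel snd)" by (rule prob_space.prob_space_distr[OF \<mu>(1) snd_m])
    fix D assume D: "D \<in> clopens cantor"
    have Db: "D \<in> sets borel" using clopens_in_sets[OF D] by (simp add: sets_borel_bseq)
    have A: "{x \<in> topspace (pair_top B). snd x \<in> D} \<in> clopens (pair_top B)"
      by (rule clopens_of_continuous[OF continuous_pair_snd[OF B]]) (use D in simp)
    have "measure \<mu> {x \<in> topspace (pair_top B). snd x \<in> D} = measure \<nu> D"
      by (rule lim_unique[OF A]) (simp add: in_top measure_shift_by[OF \<nu>p \<nu>s \<nu>i Db])
    then show "measure (distr \<mu> borel snd) D = measure \<nu> D"
      using Db by (subst measure_distr[OF snd_m]) (simp_all add: top vimage_def Int_def conj_commute)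
  qed (simp_all add: \<nu>p \<nu>s sets_borel_bseq)
  have "AE x in \<mu>. snd x \<le> phi B (fst x)"
  proof (rule AE_le_phi[OF B \<mu>])
    fix b n assume b: "b \<in> B"
    let ?A = "{x \<in> topspace (pair_top B). \<not> (n mod int b = (- fst x b) mod int b \<and> snd x n)}"
    show "measure \<mu> ?A = 1"
    proof (rule lim_unique)
      show "?A \<in> clopens (pair_top B)"
        by (intro clopens_Compl clopens_conj pair_snd_clopen[OF B] pair_fst_clopen[OF B b])
      have "measure \<nu> {y. (residues_of B (int (r k y) + int j), shift_by (int j) y) \<in> ?A} = 1" if k: "b \<le> k" for k j
      proof -
        have mem: "(residues_of B (int (r k y) + int j), shift_by (int j) y) \<in> ?A" if "y \<in> hereditary_closure_X_eta B" for y
        proof -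
          have "y \<le> shift_by (int (r k y)) (eta (B \<inter> {..k}))"
            unfolding r_def by (rule LeastI_ex[OF hereditary_closure_le_shift[OF B that]])
          then have "y (n + int j) \<Longrightarrow> \<not> int b dvd n + int j + int (r k y)"
            using b k by (auto simp: le_fun_def shift_by_def eta_iff)
          moreover have "(- residues_of B (int (r k y) + int j) b) mod int b = (- (int (r k y) + int j)) mod int b"
            using b by (simp add: residues_of_def mod_minus_eq)
          moreover have "n mod int b = (- (int (r k y) + int j)) mod int b \<longleftrightarrow> int b dvd n + int j + int (r k y)"
            by (simp add: mod_eq_dvd_iff algebra_simps)
          ultimately show ?thesis
            by (simp only: mem_Collect_eq in_top fst_conv snd_conv shift_by_def) blast
        qed
        have "{y. (residues_of B (int (r k y) + int j), shift_by (int j) y) \<in> ?A} =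
            (\<lambda>y. (pair_map B ^^ j) (f k y)) -` ?A \<inter> space \<nu>"
          by (auto simp: orb \<nu>sp)
        also have "\<dots> \<in> sets \<nu>"
          by (rule measurable_sets[OF measurable_iterate[OF continuous_pair_map[OF B] f]])
            (intro clopens_in_sets clopens_Compl clopens_conj pair_snd_clopen[OF B] pair_fst_clopen[OF B b])
        finally show ?thesis
          using AE_H mem by (subst \<nu>.prob_eq_1) (auto elim!: eventually_mono)
      qed
      then show "eventually (\<lambda>k. \<forall>j. measure \<nu> {y. (residues_of B (int (r k y) + int j), shift_by (int j) y) \<in> ?A} = 1) sequentially"
        unfolding eventually_sequentially by blast
    qed
  qed
  then show ?thesis using that[OF \<mu> inv marg] by blast
qed

theorem theorem9:
  fixes B :: "nat set" and \<nu> :: "bseq measure"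
  assumes "0 \<notin> B"
    and "\<nu> \<in> inv_prob left_shift (hereditary_closure_X_eta B)"
  shows "\<exists>\<rho> \<in> inv_prob (map_prod left_shift left_shift) (X_eta B \<times> (UNIV :: bseq set)).
           distr \<rho> borel fst = mirsky B \<and> distr \<rho> borel coord_mult = \<nu>"
proof -
  note B = assms(1)
  obtain \<mu> where \<mu>: "prob_space \<mu>" "sets \<mu> = sets (clopen_sigma (pair_top B))"
    and inv: "distr \<mu> (clopen_sigma (pair_top B)) (pair_map B) = \<mu>"
    and marg: "distr \<mu> borel snd = \<nu>" and le: "AE x in \<mu>. snd x \<le> phi B (fst x)"
    by (rule lift_invariant_measure[OF assms])
  interpret prob_space \<mu> by fact
  define h where "h x = (phi B (fst x), snd x)" for x :: "(nat \<Rightarrow> int) \<times> bseq"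
  note phi_m = measurable_pair_phi[OF B \<mu>] and snd_m = measurable_pair_snd[OF B \<mu>]
  have h: "h \<in> borel_measurable \<mu>" unfolding h_def by (rule borel_measurable_Pair[OF phi_m snd_m])
  have h': "h \<in> borel_measurable (clopen_sigma (pair_top B))"
    using h unfolding measurable_cong_sets[OF \<mu>(2) refl] .
  have fst_m: "(fst :: bseq \<times> bseq \<Rightarrow> bseq) \<in> borel_measurable borel"
    and snd_m': "(snd :: bseq \<times> bseq \<Rightarrow> bseq) \<in> borel_measurable borel"
    by (intro borel_measurable_continuous_onI continuous_intros)+
  have S_cont: "continuous_on UNIV left_shift" using continuous_left_shift by simp
  have SS: "map_prod left_shift left_shift \<in> borel_measurable borel"
    unfolding map_prod_def case_prod_unfold
    by (intro borel_measurable_continuous_onI continuous_on_Pair continuous_on_compose2[OF S_cont] continuous_intros) auto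
  have mult_m: "coord_mult \<in> borel_measurable borel"
  proof (rule borel_measurable_bseqI)
    fix n
    have y: "{y::bseq. y n} \<in> sets borel" using clopens_in_sets[OF cantor_coord_clopen[of n]] by (simp add: sets_borel_bseq)
    then have "fst -` {y. y n} \<inter> snd -` {y. y n} \<in> sets (borel :: (bseq \<times> bseq) measure)"
      using sets.Int[OF measurable_sets[OF fst_m y] measurable_sets[OF snd_m' y]] by simp
    also have "fst -` {y. y n} \<inter> snd -` {y. y n} = {x \<in> space borel. coord_mult x n}"
      by (auto simp: coord_mult_def)
    finally show "{x \<in> space borel. coord_mult x n} \<in> sets borel" .
  qed
  define \<rho> where "\<rho> = distr \<mu> borel h"
  have fst\<rho>: "distr \<rho> borel fst = mirsky B"
    unfolding \<rho>_def distr_distr[OF fst_m h] mirsky_eq_marginal[OF B \<mu> inv] by (simp add: h_def o_def)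
  have "distr \<rho> borel coord_mult = distr \<mu> borel (coord_mult \<circ> h)"
    unfolding \<rho>_def by (rule distr_distr[OF mult_m h])
  also have "\<dots> = distr \<mu> borel snd"
  proof (rule distr_cong_AE)
    show "AE x in \<mu>. (coord_mult \<circ> h) x = snd x"
      using le by eventually_elim (auto simp: coord_mult_def h_def le_fun_def)
    show "coord_mult \<circ> h \<in> borel_measurable \<mu>" by (rule measurable_comp[OF h mult_m])
  qed (use snd_m in auto)
  finally have mult\<rho>: "distr \<rho> borel coord_mult = \<nu>" using marg by simp
  have "distr \<rho> borel (map_prod left_shift left_shift) = \<rho>"
  proof -
    have "distr \<rho> borel (map_prod left_shift left_shift) = distr \<mu> borel (map_prod left_shift left_shift \<circ> h)"
      unfolding \<rho>_def by (rule distr_distr[OF SS h])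
    also have "map_prod left_shift left_shift \<circ> h = h \<circ> pair_map B"
      by (auto simp: h_def pair_map_def phi_rotate_one fun_eq_iff)
    also have "distr \<mu> borel (h \<circ> pair_map B) = distr (distr \<mu> (clopen_sigma (pair_top B)) (pair_map B)) borel h"
      by (rule distr_distr[OF h' measurable_pair_map[OF B \<mu>], symmetric])
    finally show ?thesis by (simp add: inv \<rho>_def)
  qed
  moreover have "prob_space \<rho>" unfolding \<rho>_def by (rule prob_space_distr[OF h])
  moreover have Xc: "closed (X_eta B)" by (simp add: X_eta_def)
  then have "X_eta B \<times> (UNIV :: bseq set) \<in> sets borel" by (intro borel_closed closed_Times) auto
  moreover have "emeasure \<rho> (X_eta B \<times> UNIV) = 1"
  proof -
    have "emeasure (distr \<rho> borel fst) (X_eta B) = emeasure \<rho> (X_eta B \<times> UNIV)"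
      using Xc fst_m by (subst emeasure_distr) (auto simp: \<rho>_def intro!: arg_cong[where f = "emeasure _"])
    then show ?thesis using fst\<rho> mirsky_X_eta[OF B] by simp
  qed
  ultimately have "\<rho> \<in> inv_prob (map_prod left_shift left_shift) (X_eta B \<times> UNIV)"
    using SS by (simp add: inv_prob_def \<rho>_def)
  then show ?thesis using fst\<rho> mult\<rho> by blast
qed

end
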